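(* Let $\alpha,\beta\ge-1/2$. For all $t>0$ and $\theta,\varphi\in(0,\pi)$, the Jacobi–Poisson kernel can be written as $$H_t^{\alpha,\beta}(\theta,\varphi)=c_{\alpha,\beta}\,\sinh\frac{t}{2}\iint\frac{d\Pi_\alpha(u)\,d\Pi_\beta(v)}{\big(\cosh\frac{t}{2}-1+q(\theta,\varphi,u,v)\big)^{\alpha+\beta+2}},$$ with $c_{\alpha,\beta}=2^{-\alpha-\beta-1}/\mu_{\alpha,\beta}(0,\pi)$.
   Context: For $\alpha,\beta>-1$ let $d\mu_{\alpha,\beta}(\theta)=(\sin\frac{\theta}{2})^{2\alpha+1}(\cos\frac{\theta}{2})^{2\beta+1}d\theta$ on $(0,\pi)$, let $P_n^{\alpha,\beta}$ be the classical Jacobi polynomials, $P_n^{\alpha,\beta}(x)=\frac{(-1)^n}{2^n n!}(1-x)^{-\alpha}(1+x)^{-\beta}\frac{d^n}{dx^n}\big((1-x)^{\alpha+n}(1+x)^{\beta+n}\big)$, and let $\mathcal{P}_n^{\alpha,\beta}(\theta)=c_n^{\alpha,\beta}P_n^{\alpha,\beta}(\cos\theta)$ with $c_n^{\alpha,\beta}=\|P_n^{\alpha,\beta}(\cos\theta)\|_{L^2(d\mu_{\alpha,\beta}(\theta))}^{-1}$. The Jacobi–Poisson kernel is the absolutely convergent series $H_t^{\alpha,\beta}(\theta,\varphi)=\sum_{n\ge0}e^{-t|n+\frac{\alpha+\beta+1}{2}|}\mathcal{P}_n^{\alpha,\beta}(\theta)\mathcal{P}_n^{\alpha,\beta}(\varphi)$,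 $t>0$, $\theta,\varphi\in(0,\pi)$. For $\alpha>-1/2$, $\Pi_\alpha$ is the probability measure on $[-1,1]$ given by $d\Pi_\alpha(u)=\frac{\Gamma(\alpha+1)}{\sqrt{\pi}\,\Gamma(\alpha+1/2)}(1-u^2)^{\alpha-1/2}du$, and $\Pi_{-1/2}=\frac12(\delta_{-1}+\delta_1)$ (point masses). The double integral is over $(u,v)\in[-1,1]^2$. $q(\theta,\varphi,u,v)=1-u\sin\frac{\theta}{2}\sin\frac{\varphi}{2}-v\cos\frac{\theta}{2}\cos\frac{\varphi}{2}$ for $\theta,\varphi\in(0,\pi)$, $u,v\in[-1,1]$. *)

theory Defs
  imports "HOL-Analysis.Analysis"
begin

definition jacobi_measure :: "real \<Rightarrow> real \<Rightarrow> real measure" where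
  "jacobi_measure \<alpha> \<beta> =
     density (restrict_space lborel {0<..<pi})
       (\<lambda>\<theta>. ennreal (sin (\<theta> / 2) powr (2 * \<alpha> + 1) * cos (\<theta> / 2) powr (2 * \<beta> + 1)))"

text \<open>Rodrigues' formula. It gives the Jacobi polynomial for \<open>-1 < x < 1\<close> only; elsewhere
  the value is not meaningful, but below it is only used at \<open>x = cos \<theta>\<close> with \<open>0 < \<theta> < \<pi>\<close>.\<close>

definition jacobi_P :: "nat \<Rightarrow> real \<Rightarrow> real \<Rightarrow> real \<Rightarrow> real" where
  "jacobi_P n \<alpha> \<beta> x =
     (-1) ^ n / (2 ^ n * fact n) * (1 - x) powr (-\<alpha>) * (1 + x) powr (-\<beta>)
     * (deriv ^^ n) (\<lambda>y. (1 - y) powr (\<alpha> + real n) * (1 + y) powr (\<beta> + real n)) x"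

definition jacobi_c :: "nat \<Rightarrow> real \<Rightarrow> real \<Rightarrow> real" where
  "jacobi_c n \<alpha> \<beta> =
     inverse (sqrt (\<integral>\<theta>. (jacobi_P n \<alpha> \<beta> (cos \<theta>))\<^sup>2 \<partial>jacobi_measure \<alpha> \<beta>))"

definition jacobi_trig :: "nat \<Rightarrow> real \<Rightarrow> real \<Rightarrow> real \<Rightarrow> real" where
  "jacobi_trig n \<alpha> \<beta> \<theta> = jacobi_c n \<alpha> \<beta> * jacobi_P n \<alpha> \<beta> (cos \<theta>)"

text \<open>For real terms, \<open>infsum\<close> is the sum of an absolutely convergent series
  (and 0 when the series does not converge absolutely).\<close>

definition jacobi_poisson_kernel :: "real \<Rightarrow> real \<Rightarrow> real \<Rightarrow> real \<Rightarrow> real \<Rightarrow> real" where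
  "jacobi_poisson_kernel \<alpha> \<beta> t \<theta> \<phi> =
     (\<Sum>\<^sub>\<infinity>n. exp (- t * \<bar>real n + (\<alpha> + \<beta> + 1) / 2\<bar>)
              * jacobi_trig n \<alpha> \<beta> \<theta> * jacobi_trig n \<alpha> \<beta> \<phi>)"

text \<open>A measure on the Borel sets of \<open>[-1, 1]\<close>, meant for \<open>\<alpha> \<ge> -1/2\<close>. The point masses at
  \<open>\<plusminus>1\<close> are pushed forward along the inclusion so that both cases have the same Borel
  \<open>\<sigma>\<close>-algebra. At the endpoints \<open>0 powr _ = 0\<close>, which only affects a null set.\<close>

definition Pi_measure :: "real \<Rightarrow> real measure" where
  "Pi_measure \<alpha> =
     (if \<alpha> = -1/2
      then distr (point_measure {-1, 1} (\<lambda>_. 1/2)) (restrict_space borel {-1..1}) (\<lambda>u. u)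
      else density (restrict_space lborel {-1..1})
             (\<lambda>u. ennreal (Gamma (\<alpha> + 1) / (sqrt pi * Gamma (\<alpha> + 1/2))
                           * (1 - u\<^sup>2) powr (\<alpha> - 1/2))))"

definition jacobi_q :: "real \<Rightarrow> real \<Rightarrow> real \<Rightarrow> real \<Rightarrow> real" where
  "jacobi_q \<theta> \<phi> u v =
     1 - u * sin (\<theta> / 2) * sin (\<phi> / 2) - v * cos (\<theta> / 2) * cos (\<phi> / 2)"

definition poisson_const :: "real \<Rightarrow> real \<Rightarrow> real" where
  "poisson_const \<alpha> \<beta> =
     2 powr (- \<alpha> - \<beta> - 1) / measure (jacobi_measure \<alpha> \<beta>) {0<..<pi}"

end

theory Submission
  imports Defs "HOL-Real_Asymp.Real_Asymp"
begin

text \<open>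
  Put \<open>X = sin\<^sup>2 (\<theta>/2)\<close>, \<open>Y = sin\<^sup>2 (\<phi>/2)\<close> and
  \<open>Q\<^sub>m(a, b) = \<Sum>\<^bsub>j+k=m\<^esub> a\<^sup>j b\<^sup>k / (j! k! (\<alpha>+1)\<^sub>j (\<beta>+1)\<^sub>k)\<close>. Up to a factor,
  the Jacobi polynomial is \<open>J\<^sub>n(X) = Q\<^sub>n(-X, 1-X)\<close>, and expanding the integrand into a binomial
  series turns the double integral into a series in \<open>Q\<^sub>m(XY, (1-X)(1-Y))\<close>.

  The Jacobi operator lowers the degree: applied in \<open>X\<close> to \<open>D\<^sub>m = Q\<^sub>m(XY, (1-X)(1-Y))\<close> it gives
  \<open>D\<^bsub>m-1\<^esub> - m(m+\<alpha>+\<beta>+1) D\<^sub>m\<close>. Comparing with the eigenfunctions \<open>J\<^sub>n\<close>, whose eigenvalues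
  are distinct, yields by induction on \<open>m\<close> a bilinear expansion of \<open>D\<^sub>m\<close> in the products
  \<open>J\<^sub>n(X) J\<^sub>n(Y)\<close> with explicit coefficients. After the order of summation is exchanged, the
  coefficient of each product is a series of generalised central binomial coefficients with sum
  \<open>exp(- t (n + (\<alpha>+\<beta>+1)/2)) / (2 sinh(t/2))\<close> up to elementary factors, and the norms of the
  \<open>J\<^sub>n\<close> match these factors.
\<close>

subsection \<open>Finite sums and higher derivatives\<close>

text \<open>The kernel is a series in the spectral index n, the integral a series in the degree m of
  its expansion; expanding every single degree bilinearly is what links the two. The weights 1 / (j!
  k! (\<alpha>+1)_j (\<beta>+1)_k) fit for two independent reasons. They are what the even moments
  (1/2)_j / (\<alpha>+1)_j of the measures leave of the binomial coefficients, and they absorb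
  exactly the factors j (j+\<alpha>) and k (k+\<beta>) that the Jacobi operator produces on x^j
  (1-x)^k. With e_m = m (m+\<alpha>+\<beta>+1), comparing images under the operator forces the
  expansion coefficients to satisfy (e_m - e_n) l(n,m) = l(n,m-1). Since e_m - e_n = (m-n)
  (m+n+\<alpha>+\<beta>+1), the solution is a quotient of factorials and rising factorials. The
  recursion says nothing at n = m; there the leading coefficient in X decides. The rising factorial
  in the denominator of l(n,m) finally divides the one from the binomial series, and the generalised
  central coefficients remain.\<close>

text \<open>An n-th finite difference of a polynomial of degree i in j: it vanishes below degree n
  and sees only the leading coefficient at degree n. It supplies the orthogonality in the norm
  computation. In the induction, Pascal's rule takes one difference, which lowers i by one and
  shifts a to a + 1.\<close>

lemma sum_alternating_binomial_pochhammer: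
  fixes a :: real
  assumes "i \<le> n"
  shows "(\<Sum>j\<le>n. (-1) ^ j * real (n choose j) * pochhammer (a + real j) i)
           = (if i = n then (-1) ^ n * fact n else 0)"
  using assms
proof (induction n arbitrary: i a)
  case 0
  then show ?case by simp
next
  case (Suc n)
  define f where "f j = pochhammer (a + real j) i" for j
  have "(\<Sum>j\<le>Suc n. (-1) ^ j * real (Suc n choose j) * f j)
      = f 0 + (\<Sum>j\<le>n. (-1) ^ Suc j * real (Suc n choose Suc j) * f (Suc j))"
    by (subst sum.atMost_Suc_shift) simp
  also have "\<dots> = f 0 - (\<Sum>j\<le>n. (-1) ^ j * real (n choose j) * f (Suc j))
                   + (\<Sum>j\<le>n. (-1) ^ Suc j * real (n choose Suc j) * f (Suc j))"
    by (simp add: ring_distribs sum.distrib sum_negf sum_subtractf)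
  also have "(\<Sum>j\<le>n. (-1) ^ Suc j * real (n choose Suc j) * f (Suc j))
      = (\<Sum>j\<le>Suc n. (-1) ^ j * real (n choose j) * f j) - f 0"
    by (subst sum.atMost_Suc_shift) simp
  also have "(\<Sum>j\<le>Suc n. (-1) ^ j * real (n choose j) * f j)
      = (\<Sum>j\<le>n. (-1) ^ j * real (n choose j) * f j)"
    by simp
  finally have *: "(\<Sum>j\<le>Suc n. (-1) ^ j * real (Suc n choose j) * f j)
      = (\<Sum>j\<le>n. (-1) ^ j * real (n choose j) * (f j - f (Suc j)))"
    by (simp add: sum_subtractf algebra_simps)
  show ?case
  proof (cases i)
    case 0
    then have "(\<Sum>j\<le>Suc n. (-1) ^ j * real (Suc n choose j) * f j) = 0"
      unfolding * by (simp add: f_def)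
    then show ?thesis by (simp add: f_def 0)
  next
    case (Suc i')
    have "f j - f (Suc j) = - real i * pochhammer (a + 1 + real j) i'" for j
    proof -
      have "f j = (a + real j) * pochhammer (a + 1 + real j) i'"
        by (simp add: f_def Suc pochhammer_rec algebra_simps)
      moreover have "f (Suc j) = pochhammer (a + 1 + real j) i' * (a + 1 + real j + real i')"
        by (simp add: f_def Suc pochhammer_rec' algebra_simps)
      ultimately show ?thesis by (simp add: Suc algebra_simps)
    qed
    then have "(\<Sum>j\<le>n. (-1) ^ j * real (n choose j) * (f j - f (Suc j)))
        = - real i * (\<Sum>j\<le>n. (-1) ^ j * real (n choose j) * pochhammer (a + 1 + real j) i')"
      by (simp add: sum_distrib_left mult_ac)
    also have "\<dots> = - real i * (if i' = n then (-1) ^ n * fact n else 0)"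
      using Suc Suc.prems by (subst Suc.IH) auto
    finally show ?thesis using * Suc by (auto simp add: f_def algebra_simps)
  qed
qed

lemma smult_sum_right: "smult c (sum f A) = (\<Sum>a\<in>A. smult c (f a))"
  by (induction A rule: infinite_finite_induct) (simp_all add: smult_add_right)

text \<open>The Pascal step of the Leibniz rule that follows.\<close>

lemma sum_binomial_Suc:
  fixes a :: "nat \<Rightarrow> nat \<Rightarrow> real"
  shows "(\<Sum>j\<le>n. real (n choose j) * (a (Suc j) (n - j) + a j (Suc (n - j))))
       = (\<Sum>j\<le>Suc n. real (Suc n choose j) * a j (Suc n - j))"
proof -
  have "(\<Sum>j\<le>Suc n. real (Suc n choose j) * a j (Suc n - j))
      = a 0 (Suc n) + (\<Sum>j\<le>n. real (Suc n choose Suc j) * a (Suc j) (n - j))"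
    by (subst sum.atMost_Suc_shift) simp
  also have "\<dots> = (\<Sum>j\<le>n. real (n choose j) * a (Suc j) (n - j))
      + (a 0 (Suc n) + (\<Sum>j\<le>n. real (n choose Suc j) * a (Suc j) (n - j)))"
    by (simp add: ring_distribs sum.distrib)
  also have "a 0 (Suc n) + (\<Sum>j\<le>n. real (n choose Suc j) * a (Suc j) (n - j))
      = (\<Sum>j\<le>Suc n. real (n choose j) * a j (Suc n - j))"
    by (subst sum.atMost_Suc_shift) simp
  also have "\<dots> = (\<Sum>j\<le>n. real (n choose j) * a j (Suc (n - j)))"
    by (auto intro!: sum.cong simp: Suc_diff_le)
  finally show ?thesis by (simp add: ring_distribs sum.distrib)
qed

text \<open>The iterated derivatives of both factors are supplied as explicit sequences, so the
  Leibniz rule needs no separate smoothness argument.\<close>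

lemma higher_deriv_mult_real:
  fixes F G :: "nat \<Rightarrow> real \<Rightarrow> real"
  assumes "open S"
    and F: "\<And>i x. x \<in> S \<Longrightarrow> (F i has_field_derivative F (Suc i) x) (at x)"
    and G: "\<And>i x. x \<in> S \<Longrightarrow> (G i has_field_derivative G (Suc i) x) (at x)"
    and "x \<in> S"
  shows "(deriv ^^ n) (\<lambda>y. F 0 y * G 0 y) x = (\<Sum>j\<le>n. real (n choose j) * (F j x * G (n - j) x))"
  using \<open>x \<in> S\<close>
proof (induction n arbitrary: x)
  case 0
  then show ?case by simp
next
  case (Suc n)
  have "((\<lambda>y. \<Sum>j\<le>n. real (n choose j) * (F j y * G (n - j) y)) has_field_derivative
      (\<Sum>j\<le>n. real (n choose j) * (F (Suc j) x * G (n - j) x + F j x * G (Suc (n - j)) x))) (at x)"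
    by (auto intro!: derivative_eq_intros F G Suc.prems sum.cong)
  then have "((deriv ^^ n) (\<lambda>y. F 0 y * G 0 y) has_field_derivative
      (\<Sum>j\<le>n. real (n choose j) * (F (Suc j) x * G (n - j) x + F j x * G (Suc (n - j)) x))) (at x)"
    by (rule has_field_derivative_transform_within_open[OF _ \<open>open S\<close> Suc.prems]) (simp add: Suc.IH)
  then have "(deriv ^^ Suc n) (\<lambda>y. F 0 y * G 0 y) x =
      (\<Sum>j\<le>n. real (n choose j) * (F (Suc j) x * G (n - j) x + F j x * G (Suc (n - j)) x))"
    by (simp add: DERIV_imp_deriv)
  also have "\<dots> = (\<Sum>j\<le>Suc n. real (Suc n choose j) * (F j x * G (Suc n - j) x))"
    by (rule sum_binomial_Suc[of n "\<lambda>j k. F j x * G k x"])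
  finally show ?case .
qed

lemma higher_deriv_rodrigues:
  fixes a b x :: real
  assumes "-1 < x" "x < 1"
  shows "(deriv ^^ n) (\<lambda>y. (1 - y) powr a * (1 + y) powr b) x =
    (\<Sum>j\<le>n. real (n choose j) * (pochhammer (- a) j * (1 - x) powr (a - real j)
      * ((-1) ^ (n - j) * pochhammer (- b) (n - j) * (1 + x) powr (b - real (n - j)))))"
proof -
  \<comment> \<open>Differentiating (1 - y)^(a - j) brings down -(a - j) = -a + j, the next factor
    of the rising factorial. For 1 + y the sign is opposite, hence the alternating sign in
    \<open>G\<close>.\<close>
  define F where "F j y = pochhammer (- a) j * (1 - y) powr (a - real j)" for j y
  define G where "G j y = (-1) ^ j * pochhammer (- b) j * (1 + y) powr (b - real j)" for j y
  have "(deriv ^^ n) (\<lambda>y. F 0 y * G 0 y) x = (\<Sum>j\<le>n. real (n choose j) * (F j x * G (n - j) x))"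
  proof (rule higher_deriv_mult_real[where S = "{-1<..<1}"])
    fix i and y :: real assume y: "y \<in> {-1<..<1}"
    show "(F i has_field_derivative F (Suc i) y) (at y)"
      unfolding F_def using y
      by (auto intro!: derivative_eq_intros simp: pochhammer_Suc field_simps)
    show "(G i has_field_derivative G (Suc i) y) (at y)"
      unfolding G_def using y
      by (auto intro!: derivative_eq_intros simp: pochhammer_Suc field_simps)
  qed (use assms in auto)
  then show ?thesis by (simp add: F_def G_def)
qed

text \<open>With its sign, the first rising factorial is (a + n - j + 1)_j, the tail of (a + 1)_n.
  This converts the numerators of Rodrigues' formula into the denominators of
  \<open>weight_coeff\<close>.\<close>

lemma pochhammer_minus_split:
  fixes a :: real
  assumes "j \<le> n"
  shows "(-1) ^ j * pochhammer (- (a + real n)) j * pochhammer (a + 1) (n - j) = pochhammer (a + 1) n"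
proof -
  have "(-1) ^ j * pochhammer (- (a + real n)) j = pochhammer (a + real n - real j + 1) j"
    by (subst pochhammer_minus) (simp flip: power_add mult_2)
  also have "a + real n - real j + 1 = a + 1 + real (n - j)" using assms by (simp add: of_nat_diff)
  also have "pochhammer \<dots> j * pochhammer (a + 1) (n - j) = pochhammer (a + 1) n"
    using assms by (subst (2) pochhammer_product[of "n - j"]) auto
  finally show ?thesis .
qed

subsection \<open>The Jacobi operator and the bilinear expansion\<close>

locale jacobi_parameters =
  fixes \<alpha> \<beta> :: real
  assumes \<alpha>_gt: "-1 < \<alpha>" and \<beta>_gt: "-1 < \<beta>"
begin

definition weight_coeff :: "nat \<Rightarrow> nat \<Rightarrow> real" where
  "weight_coeff j k = 1 / (fact j * fact k * pochhammer (\<alpha> + 1) j * pochhammer (\<beta> + 1) k)"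

text \<open>The part of degree m of 0F1(; \<alpha>+1; a) 0F1(; \<beta>+1; b). Summed over m with two
  further rising factorials of length m, it gives Appell's function F4.\<close>

definition appell_form :: "nat \<Rightarrow> real \<Rightarrow> real \<Rightarrow> real" where
  "appell_form m a b = (\<Sum>j\<le>m. weight_coeff j (m - j) * a ^ j * b ^ (m - j))"

definition mixed_monomial :: "nat \<Rightarrow> nat \<Rightarrow> real poly" where
  "mixed_monomial j k = [:0, 1:] ^ j * [:1, -1:] ^ k"

text \<open>The polynomial x -> \<open>appell_form m (s * x) (r * (1 - x))\<close>. One family
  serves both sides of the expansion: s = -1, r = 1 gives \<open>J\<close>, and s = y, r = 1 - y
  gives the form to be expanded.\<close>

definition appell_poly :: "nat \<Rightarrow> real \<Rightarrow> real \<Rightarrow> real poly" where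
  "appell_poly m s r = (\<Sum>j\<le>m. smult (weight_coeff j (m - j) * s ^ j * r ^ (m - j)) (mixed_monomial j (m - j)))"

text \<open>Jacobi's differential operator in the variable (1 - cos \<theta>) / 2, that is, the
  hypergeometric operator on [0, 1].\<close>

definition jacobi_op :: "real poly \<Rightarrow> real poly" where
  "jacobi_op p = [:0, 1, -1:] * pderiv (pderiv p) + [:\<alpha> + 1, - (\<alpha> + \<beta> + 2):] * pderiv p"

lemma pochhammer_parameter_pos: "0 < pochhammer (\<alpha> + 1) j" "0 < pochhammer (\<beta> + 1) j"
  using \<alpha>_gt \<beta>_gt by (auto intro!: pochhammer_pos)

lemma weight_coeff_pos: "0 < weight_coeff j k"
  unfolding weight_coeff_def using pochhammer_parameter_pos by simp

lemma weight_coeff_Suc: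
  "real (Suc j) * (real (Suc j) + \<alpha>) * weight_coeff (Suc j) k = weight_coeff j k"
  "real (Suc k) * (real (Suc k) + \<beta>) * weight_coeff j (Suc k) = weight_coeff j k"
proof -
  have "real (Suc j) + \<alpha> \<noteq> 0" "real (Suc k) + \<beta> \<noteq> 0" using \<alpha>_gt \<beta>_gt by linarith+
  moreover have "pochhammer (\<alpha> + 1) (Suc j) = (real (Suc j) + \<alpha>) * pochhammer (\<alpha> + 1) j"
     "pochhammer (\<beta> + 1) (Suc k) = (real (Suc k) + \<beta>) * pochhammer (\<beta> + 1) k"
    by (simp_all add: pochhammer_Suc algebra_simps)
  ultimately show "real (Suc j) * (real (Suc j) + \<alpha>) * weight_coeff (Suc j) k = weight_coeff j k"
    "real (Suc k) * (real (Suc k) + \<beta>) * weight_coeff j (Suc k) = weight_coeff j k"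
    unfolding weight_coeff_def fact_Suc of_nat_mult by (simp_all del: of_nat_Suc)
qed

lemma poly_appell_poly: "poly (appell_poly m s r) x = appell_form m (s * x) (r * (1 - x))"
  by (simp add: appell_poly_def appell_form_def mixed_monomial_def poly_sum power_mult_distrib mult_ac)

lemma pderiv_mixed_monomial:
  "pderiv (mixed_monomial j k) = smult (real j) (mixed_monomial (j - 1) k) - smult (real k) (mixed_monomial j (k - 1))"
proof -
  have "pderiv ([:0, 1:] ^ j) = smult (real j) ([:0, 1::real:] ^ (j - 1))"
    by (cases j) (simp_all add: pderiv_power_Suc pderiv_pCons del: power_Suc)
  moreover have "pderiv ([:1, -1:] ^ k) = smult (- real k) ([:1, -1::real:] ^ (k - 1))"
    by (cases k) (simp_all add: pderiv_power_Suc pderiv_pCons del: power_Suc)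
  ultimately show ?thesis
    by (simp add: mixed_monomial_def pderiv_mult mult.commute)
qed

lemma jacobi_op_add: "jacobi_op (p + q) = jacobi_op p + jacobi_op q"
  by (simp add: jacobi_op_def pderiv_add ring_distribs)

lemma jacobi_op_smult: "jacobi_op (smult c p) = smult c (jacobi_op p)"
  by (simp add: jacobi_op_def pderiv_smult smult_add_right)

lemma jacobi_op_0: "jacobi_op 0 = 0"
  by (simp add: jacobi_op_def)

lemma jacobi_op_sum: "jacobi_op (sum f A) = (\<Sum>a\<in>A. jacobi_op (f a))"
  by (induction A rule: infinite_finite_induct) (simp_all add: jacobi_op_add jacobi_op_0)

text \<open>With y = 1 - x the operator reads x y p'' + ((\<alpha>+1) y - (\<beta>+1) x) p', which
  treats x and y alike up to sign. Hence the basis x^j y^k: each image has only the two neighbours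
  of lower degree besides the diagonal term.\<close>

lemma jacobi_op_mixed_monomial:
  "jacobi_op (mixed_monomial j k) = smult (real j * (real j + \<alpha>)) (mixed_monomial (j - 1) k)
     + smult (real k * (real k + \<beta>)) (mixed_monomial j (k - 1))
     - smult (real (j + k) * (real (j + k) + (\<alpha> + \<beta> + 1))) (mixed_monomial j k)"
  (is "?l = ?r")
proof -
  have "poly ?l x = poly ?r x" for x
  proof -
    define y where "y = 1 - x"
    have b: "poly (mixed_monomial j k) x = x ^ j * y ^ k" for j k by (simp add: mixed_monomial_def y_def)
    have x: "x = 1 - y" by (simp add: y_def)
    have d1: "poly (pderiv (mixed_monomial j k)) x
        = real j * x ^ (j - 1) * y ^ k - real k * x ^ j * y ^ (k - 1)" for j k
      by (simp add: pderiv_mixed_monomial b)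
    have d2: "poly (pderiv (pderiv (mixed_monomial j k))) x
        = real j * (real (j - 1) * x ^ (j - 1 - 1) * y ^ k - real k * x ^ (j - 1) * y ^ (k - 1))
        - real k * (real j * x ^ (j - 1) * y ^ (k - 1) - real (k - 1) * x ^ j * y ^ (k - 1 - 1))"
      by (subst pderiv_mixed_monomial) (simp add: pderiv_diff pderiv_smult d1)
    \<comment> \<open>The truncated exponents j - 1 and j - 1 - 1 are harmless: where truncation
      occurs, the coefficient in front is zero.\<close>
    have e1: "x * (real j * x ^ (j - 1)) = real j * x ^ j" for j by (cases j) auto
    have e2: "y * (real k * y ^ (k - 1)) = real k * y ^ k" for k by (cases k) auto
    have e3: "x * (real j * real (j - 1) * x ^ (j - 1 - 1)) = real j * (real j - 1) * x ^ (j - 1)"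
      by (cases j; cases "j - 1") (auto simp: algebra_simps)
    have e4: "y * (real k * real (k - 1) * y ^ (k - 1 - 1)) = real k * (real k - 1) * y ^ (k - 1)"
      by (cases k; cases "k - 1") (auto simp: algebra_simps)
    define A where "A = real j * x ^ (j - 1)"
    define B where "B = real k * y ^ (k - 1)"
    have "poly ?l x = x * y * poly (pderiv (pderiv (mixed_monomial j k))) x
        + ((\<alpha> + 1) * y - (\<beta> + 1) * x) * poly (pderiv (mixed_monomial j k)) x"
      by (simp add: jacobi_op_def y_def algebra_simps)
    also have "poly (pderiv (mixed_monomial j k)) x = A * y ^ k - B * x ^ j"
      by (simp add: d1 A_def B_def)
    also have "x * y * poly (pderiv (pderiv (mixed_monomial j k))) x
        = (x * (real j * real (j - 1) * x ^ (j - 1 - 1))) * (y * y ^ k)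
          - 2 * (x * (real j * x ^ (j - 1))) * (y * (real k * y ^ (k - 1)))
          + (y * (real k * real (k - 1) * y ^ (k - 1 - 1))) * (x * x ^ j)"
      unfolding d2 by (simp add: algebra_simps)
    also have "\<dots> = (real j - 1) * A * (y * y ^ k) - 2 * (x * A) * (y * B)
                   + (real k - 1) * B * (x * x ^ j)"
      unfolding e3 e4 by (simp add: A_def B_def)
    finally have l: "poly ?l x = (real j - 1) * A * (y * y ^ k) - 2 * (x * A) * (y * B)
                   + (real k - 1) * B * (x * x ^ j)
                   + ((\<alpha> + 1) * y - (\<beta> + 1) * x) * (A * y ^ k - B * x ^ j)" .
    have r: "poly ?r x = (real j + \<alpha>) * A * y ^ k + (real k + \<beta>) * B * x ^ j
        - (real j + real k) * (real j + real k + (\<alpha> + \<beta> + 1)) * (x ^ j * y ^ k)"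
      by (simp add: b A_def B_def algebra_simps)
    have xA: "x * A = real j * x ^ j" and yB: "y * B = real k * y ^ k"
      unfolding A_def B_def by (rule e1, rule e2)
    \<comment> \<open>Here x + y = 1 enters: it splits y A and x B into the lower monomial and one
      of full degree.\<close>
    have yA: "y * A = A - real j * x ^ j" and xB: "x * B = B - real k * y ^ k"
      using xA yB by (simp_all add: x algebra_simps)
    have "poly ?l x = (real j + \<alpha>) * (y * A) * y ^ k - 2 * (x * A) * (y * B)
                   + (real k + \<beta>) * (x * B) * x ^ j
                   - (\<alpha> + 1) * (y * B) * x ^ j - (\<beta> + 1) * (x * A) * y ^ k"
      unfolding l by (simp add: algebra_simps)
    also have "\<dots> = poly ?r x"
      unfolding r xA yB yA xB by (simp add: algebra_simps)
    finally show ?thesis .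
  qed
  then show ?thesis by (auto simp: poly_eq_poly_eq_iff[symmetric])
qed

text \<open>By \<open>weight_coeff_Suc\<close> the terms lowering j reassemble to s times, and those
  lowering k to r times, the same polynomial of index m - 1. So only s + r matters: it is 0 for
  \<open>J\<close>, which becomes an eigenfunction, and 1 for s = y, r = 1 - y.\<close>

lemma jacobi_op_appell_poly:
  "jacobi_op (appell_poly m s r) = (if m = 0 then 0 else smult (s + r) (appell_poly (m - 1) s r))
      - smult (real m * (real m + (\<alpha> + \<beta> + 1))) (appell_poly m s r)"
proof -
  define e where "e = real m * (real m + (\<alpha> + \<beta> + 1))"
  define c where "c j = weight_coeff j (m - j) * s ^ j * r ^ (m - j)" for j
  have 1: "jacobi_op (appell_poly m s r)
      = (\<Sum>j\<le>m. smult (c j * (real j * (real j + \<alpha>))) (mixed_monomial (j - 1) (m - j)))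
      + (\<Sum>j\<le>m. smult (c j * (real (m - j) * (real (m - j) + \<beta>))) (mixed_monomial j (m - j - 1)))
      - smult e (appell_poly m s r)"
  proof -
    have "jacobi_op (appell_poly m s r) = (\<Sum>j\<le>m. smult (c j) (jacobi_op (mixed_monomial j (m - j))))"
      by (simp add: appell_poly_def jacobi_op_sum jacobi_op_smult c_def)
    also have "\<dots> = (\<Sum>j\<le>m. smult (c j * (real j * (real j + \<alpha>))) (mixed_monomial (j - 1) (m - j))
      + smult (c j * (real (m - j) * (real (m - j) + \<beta>))) (mixed_monomial j (m - j - 1))
      - smult e (smult (c j) (mixed_monomial j (m - j))))"
      by (intro sum.cong refl) (simp add: jacobi_op_mixed_monomial smult_add_right smult_diff_right e_def algebra_simps)
    also have "\<dots> = (\<Sum>j\<le>m. smult (c j * (real j * (real j + \<alpha>))) (mixed_monomial (j - 1) (m - j)))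
      + (\<Sum>j\<le>m. smult (c j * (real (m - j) * (real (m - j) + \<beta>))) (mixed_monomial j (m - j - 1)))
      - (\<Sum>j\<le>m. smult e (smult (c j) (mixed_monomial j (m - j))))"
      by (simp only: sum_subtractf sum.distrib)
    also have "(\<Sum>j\<le>m. smult e (smult (c j) (mixed_monomial j (m - j)))) = smult e (appell_poly m s r)"
      by (simp add: appell_poly_def c_def smult_sum_right)
    finally show ?thesis .
  qed
  show ?thesis
  proof (cases m)
    case 0
    then show ?thesis using 1 by (simp add: e_def)
  next
    case (Suc n)
    have a: "(\<Sum>j\<le>m. smult (c j * (real j * (real j + \<alpha>))) (mixed_monomial (j - 1) (m - j)))
       = smult s (appell_poly n s r)"
    proof -
      have "(\<Sum>j\<le>m. smult (c j * (real j * (real j + \<alpha>))) (mixed_monomial (j - 1) (m - j)))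
        = (\<Sum>j\<le>n. smult (c (Suc j) * (real (Suc j) * (real (Suc j) + \<alpha>))) (mixed_monomial j (n - j)))"
        unfolding Suc by (subst sum.atMost_Suc_shift) simp
      also have "\<dots> = (\<Sum>j\<le>n. smult s (smult (weight_coeff j (n - j) * s ^ j * r ^ (n - j)) (mixed_monomial j (n - j))))"
      proof (intro sum.cong refl)
        fix j
        have "c (Suc j) * (real (Suc j) * (real (Suc j) + \<alpha>)) =
          (real (Suc j) * (real (Suc j) + \<alpha>) * weight_coeff (Suc j) (n - j)) * s ^ Suc j * r ^ (n - j)"
          by (simp add: c_def Suc)
        also have "\<dots> = s * (weight_coeff j (n - j) * s ^ j * r ^ (n - j))"
          unfolding weight_coeff_Suc by simp
        finally show "smult (c (Suc j) * (real (Suc j) * (real (Suc j) + \<alpha>))) (mixed_monomial j (n - j))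
          = smult s (smult (weight_coeff j (n - j) * s ^ j * r ^ (n - j)) (mixed_monomial j (n - j)))" by simp
      qed
      also have "\<dots> = smult s (appell_poly n s r)"
        by (simp add: appell_poly_def smult_sum_right)
      finally show ?thesis .
    qed
    have b: "(\<Sum>j\<le>m. smult (c j * (real (m - j) * (real (m - j) + \<beta>))) (mixed_monomial j (m - j - 1)))
       = smult r (appell_poly n s r)"
    proof -
      have "(\<Sum>j\<le>m. smult (c j * (real (m - j) * (real (m - j) + \<beta>))) (mixed_monomial j (m - j - 1)))
        = (\<Sum>j\<le>n. smult (c j * (real (m - j) * (real (m - j) + \<beta>))) (mixed_monomial j (m - j - 1)))"
        unfolding Suc by simp
      also have "\<dots> = (\<Sum>j\<le>n. smult r (smult (weight_coeff j (n - j) * s ^ j * r ^ (n - j)) (mixed_monomial j (n - j))))"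
      proof (intro sum.cong refl)
        fix j assume "j \<in> {..n}"
        then have mj: "m - j = Suc (n - j)" using Suc by auto
        have "c j * (real (m - j) * (real (m - j) + \<beta>)) =
          (real (Suc (n - j)) * (real (Suc (n - j)) + \<beta>) * weight_coeff j (Suc (n - j))) * s ^ j * r ^ Suc (n - j)"
          by (simp add: c_def mj)
        also have "\<dots> = r * (weight_coeff j (n - j) * s ^ j * r ^ (n - j))"
          unfolding weight_coeff_Suc by simp
        finally show "smult (c j * (real (m - j) * (real (m - j) + \<beta>))) (mixed_monomial j (m - j - 1))
          = smult r (smult (weight_coeff j (n - j) * s ^ j * r ^ (n - j)) (mixed_monomial j (n - j)))"
          by (simp add: mj)
      qed
      also have "\<dots> = smult r (appell_poly n s r)"
        by (simp add: appell_poly_def smult_sum_right)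
      finally show ?thesis .
    qed
    show ?thesis unfolding 1 a b by (simp add: Suc e_def smult_add_left)
  qed
qed

lemma coeff_mixed_monomial:
  "i > j + k \<Longrightarrow> coeff (mixed_monomial j k) i = 0" "coeff (mixed_monomial j k) (j + k) = (-1) ^ k"
proof -
  have d: "degree ([:0, 1::real:] ^ j) = j" "degree ([:1, -1::real:] ^ k) = k"
    by (simp_all add: degree_power_eq)
  then have db: "degree (mixed_monomial j k) = j + k"
    unfolding mixed_monomial_def by (subst degree_mult_eq) auto
  then show "i > j + k \<Longrightarrow> coeff (mixed_monomial j k) i = 0" by (simp add: coeff_eq_0)
  have "lead_coeff (mixed_monomial j k) = (-1) ^ k"
    by (simp add: mixed_monomial_def lead_coeff_mult lead_coeff_power)
  then show "coeff (mixed_monomial j k) (j + k) = (-1) ^ k" using db by simp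
qed

text \<open>The leading coefficient of (1 - x)^k is (-1)^k, which has the effect of replacing r by
  -r.\<close>

lemma coeff_appell_poly:
  "i > m \<Longrightarrow> coeff (appell_poly m s r) i = 0" "coeff (appell_poly m s r) m = appell_form m s (- r)"
proof -
  show "i > m \<Longrightarrow> coeff (appell_poly m s r) i = 0"
    by (auto simp: appell_poly_def coeff_sum coeff_mixed_monomial intro!: sum.neutral)
  have "coeff (mixed_monomial j (m - j)) m = (-1) ^ (m - j)" if "j \<le> m" for j
    using coeff_mixed_monomial(2)[of j "m - j"] that by simp
  then show "coeff (appell_poly m s r) m = appell_form m s (- r)"
    by (auto simp: appell_poly_def appell_form_def coeff_sum power_minus[of r] intro!: sum.cong)
qed

lemma appell_form_minus: "appell_form m (- a) (- b) = (-1) ^ m * appell_form m a b"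
  unfolding appell_form_def sum_distrib_left
proof (intro sum.cong refl)
  fix j assume "j \<in> {..m}"
  then have "(-1::real) ^ m = (-1) ^ j * (-1) ^ (m - j)" by (simp flip: power_add)
  then show "weight_coeff j (m - j) * (- a) ^ j * (- b) ^ (m - j) =
         (- 1) ^ m * (weight_coeff j (m - j) * a ^ j * b ^ (m - j))"
    by (simp add: power_minus[of a] power_minus[of b])
qed

lemma appell_form_one_pos: "0 < appell_form m 1 1"
  unfolding appell_form_def by (intro sum_pos) (auto simp: weight_coeff_pos)

text \<open>The operator multiplies the leading coefficient at degree d by -d
  (d+\<alpha>+\<beta>+1), since the other contributions involve the vanishing coefficient d + 1.
  Equality of the eigenvalues means (m - d) (m + d + \<alpha> + \<beta> + 1) = 0, impossible for d <
  m because m \<ge> 1 and \<alpha> + \<beta> > -2.\<close>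

lemma jacobi_op_eigen_unique:
  assumes "jacobi_op p = - smult (real m * (real m + (\<alpha> + \<beta> + 1))) p"
    and "\<And>i. i \<ge> m \<Longrightarrow> coeff p i = 0"
  shows "p = 0"
proof (rule ccontr)
  assume "p \<noteq> 0"
  define d where "d = degree p"
  have lc: "coeff p d \<noteq> 0" using \<open>p \<noteq> 0\<close> by (simp add: d_def)
  then have dm: "d < m" using assms(2) not_le_imp_less by blast
  have c1: "coeff p (Suc d) = 0" "coeff p (Suc (Suc d)) = 0" by (simp_all add: d_def coeff_eq_0)
  have "coeff (jacobi_op p) d = - (real d * (real d + (\<alpha> + \<beta> + 1)) * coeff p d)"
    using c1 unfolding jacobi_op_def
    by (cases d; cases "d - 1") (auto simp: coeff_pCons coeff_pderiv algebra_simps split: nat.splits)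
  then have "real d * (real d + (\<alpha> + \<beta> + 1)) * coeff p d = real m * (real m + (\<alpha> + \<beta> + 1)) * coeff p d"
    using assms(1) by (simp only: coeff_minus coeff_smult neg_equal_iff_equal)
  then have "real d * (real d + (\<alpha> + \<beta> + 1)) = real m * (real m + (\<alpha> + \<beta> + 1))"
    using lc by simp
  then have "(real m - real d) * (real m + real d + (\<alpha> + \<beta> + 1)) = 0" by (simp add: algebra_simps)
  moreover have "real m \<ge> 1" "real d \<ge> 0" using dm by auto
  ultimately show False using dm \<alpha>_gt \<beta>_gt by (smt (verit) mult_eq_0_iff of_nat_less_iff)
qed

definition J :: "nat \<Rightarrow> real \<Rightarrow> real" where
  "J n x = appell_form n (- x) (1 - x)"

lemma poly_J: "J n x = poly (appell_poly n (-1) 1) x"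
  by (simp add: J_def poly_appell_poly)

lemma coeff_J: "coeff (appell_poly n (-1) 1) n = (-1) ^ n * appell_form n 1 1"
  using appell_form_minus[of n 1 1] by (simp add: coeff_appell_poly)

lemma jacobi_op_J:
  "jacobi_op (appell_poly n (-1) 1) = - smult (real n * (real n + (\<alpha> + \<beta> + 1))) (appell_poly n (-1) 1)"
  by (simp add: jacobi_op_appell_poly)

text \<open>The denominator is the product of the eigenvalue differences (i - n) (i + n + \<alpha> +
  \<beta> + 1) over n < i \<le> m, times the leading coefficient of \<open>J n\<close> up to
  sign.\<close>

definition link_coeff :: "nat \<Rightarrow> nat \<Rightarrow> real" where
  "link_coeff n m = 1 / (appell_form n 1 1 * fact (m - n) * pochhammer (2 * real n + (\<alpha> + \<beta> + 2)) (m - n))"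

lemma link_coeff_pos: "0 < link_coeff n m"
  unfolding link_coeff_def using appell_form_one_pos \<alpha>_gt \<beta>_gt
  by (auto intro!: mult_pos_pos pochhammer_pos)

lemma link_coeff_Suc:
  assumes "n \<le> m"
  shows "(real (Suc m) * (real (Suc m) + (\<alpha> + \<beta> + 1)) - real n * (real n + (\<alpha> + \<beta> + 1))) * link_coeff n (Suc m)
         = link_coeff n m"
proof -
  define k where "k = m - n"
  have m: "m = n + k" using assms by (simp add: k_def)
  define b where "b = 2 * real n + (\<alpha> + \<beta> + 2)"
  have b: "b + real k > 0" using \<alpha>_gt \<beta>_gt by (simp add: b_def)
  have "real (Suc m) * (real (Suc m) + (\<alpha> + \<beta> + 1)) - real n * (real n + (\<alpha> + \<beta> + 1))
     = real (Suc k) * (b + real k)"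
    by (simp add: m b_def algebra_simps)
  moreover have "Suc m - n = Suc k" "m - n = k" by (simp_all add: m)
  ultimately show ?thesis
    unfolding link_coeff_def b_def[symmetric] using b
    by (simp add: pochhammer_Suc fact_Suc del: of_nat_Suc)
qed

lemma appell_form_bilinear:
  "appell_form m (x * y) ((1 - x) * (1 - y)) = (\<Sum>n\<le>m. link_coeff n m * J n x * J n y)"
proof -
  \<comment> \<open>The defect of the expansion, as a polynomial in x with y a fixed
    parameter.\<close>
  define E where "E m = appell_poly m y (1 - y)
      - (\<Sum>n\<le>m. smult (link_coeff n m * J n y) (appell_poly n (-1) 1))" for m
  have "E m = 0"
  proof (induction m)
    case 0
    have "appell_poly 0 s r = 1" for s r
      by (simp add: appell_poly_def mixed_monomial_def weight_coeff_def)
    then show ?case by (simp add: E_def link_coeff_def J_def appell_form_def weight_coeff_def)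
  next
    case (Suc m)
    let ?e = "\<lambda>n. real n * (real n + (\<alpha> + \<beta> + 1))"
    have "jacobi_op (E (Suc m)) = appell_poly m y (1 - y) - smult (?e (Suc m)) (appell_poly (Suc m) y (1 - y))
       + (\<Sum>n\<le>Suc m. smult (link_coeff n (Suc m) * J n y * ?e n) (appell_poly n (-1) 1))"
    proof -
      have diff: "jacobi_op (p - q) = jacobi_op p - jacobi_op q" for p q
        using jacobi_op_add[of "p - q" q] by simp
      show ?thesis
        unfolding E_def diff jacobi_op_sum jacobi_op_smult jacobi_op_J
        by (simp add: jacobi_op_appell_poly sum_negf)
    qed
    also have "(\<Sum>n\<le>Suc m. smult (link_coeff n (Suc m) * J n y * ?e n) (appell_poly n (-1) 1))
       = smult (?e (Suc m)) (\<Sum>n\<le>Suc m. smult (link_coeff n (Suc m) * J n y) (appell_poly n (-1) 1))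
          - (\<Sum>n\<le>m. smult (link_coeff n m * J n y) (appell_poly n (-1) 1))"
    proof -
      have "smult (?e (Suc m)) (\<Sum>n\<le>Suc m. smult (link_coeff n (Suc m) * J n y) (appell_poly n (-1) 1))
         - (\<Sum>n\<le>Suc m. smult (link_coeff n (Suc m) * J n y * ?e n) (appell_poly n (-1) 1))
        = (\<Sum>n\<le>Suc m. smult ((?e (Suc m) - ?e n) * link_coeff n (Suc m) * J n y) (appell_poly n (-1) 1))"
        unfolding smult_sum_right sum_subtractf[symmetric]
        by (intro sum.cong refl) (simp add: smult_diff_left[symmetric] algebra_simps)
      also have "\<dots> = (\<Sum>n\<le>m. smult ((?e (Suc m) - ?e n) * link_coeff n (Suc m) * J n y) (appell_poly n (-1) 1))"
        by simp
      also have "\<dots> = (\<Sum>n\<le>m. smult (link_coeff n m * J n y) (appell_poly n (-1) 1))"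
      proof (intro sum.cong refl)
        fix n assume "n \<in> {..m}"
        then have "n \<le> m" by simp
        show "smult ((?e (Suc m) - ?e n) * link_coeff n (Suc m) * J n y) (appell_poly n (-1) 1)
          = smult (link_coeff n m * J n y) (appell_poly n (-1) 1)"
          unfolding link_coeff_Suc[OF \<open>n \<le> m\<close>] ..
      qed
      finally show ?thesis by (simp add: algebra_simps)
    qed
    \<comment> \<open>The defects obey the recursion of the forms themselves. Once
      \<open>E m\<close> vanishes, the next defect is an eigenfunction, and it remains to see that
      its degree is too small.\<close>
    finally have "jacobi_op (E (Suc m)) = E m - smult (?e (Suc m)) (E (Suc m))"
      by (simp add: E_def smult_diff_right)
    then have 1: "jacobi_op (E (Suc m)) = - smult (?e (Suc m)) (E (Suc m))" using Suc by simp
    have "coeff (E (Suc m)) i = 0" if "i \<ge> Suc m" for i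
    proof (cases "i = Suc m")
      case False
      then have "i > Suc m" using that by simp
      then show ?thesis by (simp add: E_def coeff_sum coeff_appell_poly)
    next
      case True
      \<comment> \<open>The leading coefficient in x is again \<open>J\<close> in y, up to sign.
        This makes the top coefficients cancel and accounts for the symmetric product in the
        expansion.\<close>
      have "coeff (appell_poly (Suc m) y (1 - y)) (Suc m) = (-1) ^ Suc m * J (Suc m) y"
        using appell_form_minus[of "Suc m" "- y" "1 - y"] by (simp add: coeff_appell_poly J_def)
      moreover have "link_coeff (Suc m) (Suc m) * appell_form (Suc m) 1 1 = 1"
        using appell_form_one_pos[of "Suc m"] by (simp add: link_coeff_def)
      ultimately show ?thesis unfolding True
        by (simp add: E_def coeff_sum coeff_appell_poly(1) coeff_J)
    qed
    then show ?case by (rule jacobi_op_eigen_unique[OF 1])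
  qed
  then have "poly (appell_poly m y (1 - y)) x
      = poly (\<Sum>n\<le>m. smult (link_coeff n m * J n y) (appell_poly n (-1) 1)) x"
    by (simp add: E_def)
  then show ?thesis
    by (simp add: poly_appell_poly poly_sum poly_J mult_ac)
qed

subsection \<open>Jacobi polynomials and their norms\<close>

lemma jacobi_P_eq_J:
  assumes "-1 < x" "x < 1"
  shows "jacobi_P n \<alpha> \<beta> x = pochhammer (\<alpha> + 1) n * pochhammer (\<beta> + 1) n * J n ((1 - x) / 2)"
proof -
  define X where "X = (1 - x) / 2"
  have X: "1 - x = 2 * X" "1 + x = 2 * (1 - X)" "0 < X" "X < 1"
    using assms by (simp_all add: X_def field_simps)
  have "jacobi_P n \<alpha> \<beta> x = (-1) ^ n / (2 ^ n * fact n) * (1 - x) powr (- \<alpha>) * (1 + x) powr (- \<beta>) *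
     (\<Sum>j\<le>n. real (n choose j) * (pochhammer (- (\<alpha> + real n)) j * (1 - x) powr (\<alpha> + real n - real j)
      * ((-1) ^ (n - j) * pochhammer (- (\<beta> + real n)) (n - j) * (1 + x) powr (\<beta> + real n - real (n - j)))))"
    unfolding jacobi_P_def higher_deriv_rodrigues[OF assms] ..
  \<comment> \<open>Here j counts the derivatives that fall on the factor in 1 - x, which leaves the
    power n - j of X; the indices are therefore reversed until the final reindexing.\<close>
  also have "\<dots> = (\<Sum>j\<le>n. pochhammer (\<alpha> + 1) n * pochhammer (\<beta> + 1) n *
      (weight_coeff (n - j) j * (- X) ^ (n - j) * (1 - X) ^ j))"
    unfolding sum_distrib_left
  proof (intro sum.cong refl)
    fix j assume "j \<in> {..n}"
    then have j: "j \<le> n" by simp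
    then obtain k where n: "n = j + k" using le_Suc_ex by blast
    have p1: "(1 - x) powr (- \<alpha>) * (1 - x) powr (\<alpha> + real n - real j) = 2 ^ k * X ^ k"
      unfolding X(1) using X(3,4) by (simp add: n powr_realpow power_mult_distrib flip: powr_add)
    have p2: "(1 + x) powr (- \<beta>) * (1 + x) powr (\<beta> + real n - real k) = 2 ^ j * (1 - X) ^ j"
      unfolding X(2) using X(3,4)
      by (simp add: n powr_realpow power_mult_distrib del: right_diff_distrib_numeral flip: powr_add)
    have q1: "(-1) ^ j * pochhammer (- (\<alpha> + real n)) j = pochhammer (\<alpha> + 1) n / pochhammer (\<alpha> + 1) k"
      using pochhammer_minus_split[of j n \<alpha>] pochhammer_parameter_pos(1)[of k] by (simp add: n field_simps)
    have q2: "(-1) ^ k * pochhammer (- (\<beta> + real n)) k = pochhammer (\<beta> + 1) n / pochhammer (\<beta> + 1) j"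
      using pochhammer_minus_split[of k n \<beta>] pochhammer_parameter_pos(2)[of j] by (simp add: n field_simps)
    have bin: "real (n choose j) / fact n = 1 / (fact j * fact k)"
      by (simp add: n binomial_fact)
    have "(-1) ^ n / (2 ^ n * fact n) * (1 - x) powr (- \<alpha>) * (1 + x) powr (- \<beta>) *
     (real (n choose j) * (pochhammer (- (\<alpha> + real n)) j * (1 - x) powr (\<alpha> + real n - real j)
      * ((-1) ^ (n - j) * pochhammer (- (\<beta> + real n)) (n - j) * (1 + x) powr (\<beta> + real n - real (n - j)))))
      = (real (n choose j) / fact n) * ((-1) ^ k / 2 ^ n) *
        ((1 - x) powr (- \<alpha>) * (1 - x) powr (\<alpha> + real n - real j)) *
        ((1 + x) powr (- \<beta>) * (1 + x) powr (\<beta> + real n - real k)) *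
        ((-1) ^ j * pochhammer (- (\<alpha> + real n)) j) *
        ((-1) ^ k * pochhammer (- (\<beta> + real n)) k)"
    proof -
      have rearrange: "A * B / (u * v) * c * d * (e * (f * g * (B * h * r)))
          = (e / v) * (B / u) * (c * g) * (d * r) * (A * f) * (B * h)" for A B u v c d e f g h r :: real
        by (simp add: mult_ac)
      have "(-1::real) ^ n = (-1) ^ j * (-1) ^ k" "n - j = k" by (simp_all add: n power_add)
      then show ?thesis by (simp only: ) (rule rearrange)
    qed
    also have "\<dots> = pochhammer (\<alpha> + 1) n * pochhammer (\<beta> + 1) n *
      (weight_coeff (n - j) j * (- X) ^ (n - j) * (1 - X) ^ j)"
      unfolding p1 p2 q1 q2 bin by (simp add: n weight_coeff_def power_add power_minus[of X] mult_ac)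
    finally show "(-1) ^ n / (2 ^ n * fact n) * (1 - x) powr (- \<alpha>) * (1 + x) powr (- \<beta>) *
     (real (n choose j) * (pochhammer (- (\<alpha> + real n)) j * (1 - x) powr (\<alpha> + real n - real j)
      * ((-1) ^ (n - j) * pochhammer (- (\<beta> + real n)) (n - j) * (1 + x) powr (\<beta> + real n - real (n - j)))))
      = pochhammer (\<alpha> + 1) n * pochhammer (\<beta> + 1) n *
      (weight_coeff (n - j) j * (- X) ^ (n - j) * (1 - X) ^ j)" .
  qed
  also have "\<dots> = pochhammer (\<alpha> + 1) n * pochhammer (\<beta> + 1) n *
      (\<Sum>j\<le>n. weight_coeff (n - j) j * (- X) ^ (n - j) * (1 - X) ^ j)"
    by (simp add: sum_distrib_left)
  also have "(\<Sum>j\<le>n. weight_coeff (n - j) j * (- X) ^ (n - j) * (1 - X) ^ j) = J n X"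
    unfolding J_def appell_form_def
    by (rule sum.reindex_bij_witness[of _ "\<lambda>j. n - j" "\<lambda>j. n - j"]) auto
  finally show ?thesis by (simp add: X_def)
qed

lemma has_integral_beta_monomial:
  "((\<lambda>x. x powr \<alpha> * (1 - x) powr \<beta> * (x ^ i * (1 - x) ^ k)) has_integral
      Beta (\<alpha> + 1 + real i) (\<beta> + 1 + real k)) {0<..<1}"
proof -
  have "((\<lambda>t. t powr (\<alpha> + 1 + real i - 1) * (1 - t) powr (\<beta> + 1 + real k - 1)) has_integral
      Beta (\<alpha> + 1 + real i) (\<beta> + 1 + real k)) {0<..<1}"
    using has_integral_Beta_real[of "\<alpha> + 1 + real i" "\<beta> + 1 + real k"] \<alpha>_gt \<beta>_gt
    by (simp add: has_integral_Icc_iff_Ioo)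
  then show ?thesis
    by (rule has_integral_eq[rotated]) (simp add: powr_add powr_realpow)
qed

text \<open>The rising factorials in \<open>weight_coeff\<close> cancel against those of the Beta
  value. What still depends on j is a binomial coefficient times a polynomial of degree i in j, the
  shape required by \<open>sum_alternating_binomial_pochhammer\<close>.\<close>

lemma Beta_shift:
  assumes "j \<le> n"
  shows "weight_coeff j (n - j) * Beta (\<alpha> + 1 + real (i + j)) (\<beta> + 1 + real (n - j)) =
    Gamma (\<alpha> + 1) * Gamma (\<beta> + 1) / (fact n * Gamma (\<alpha> + \<beta> + 2 + real (n + i))) *
      (real (n choose j) * pochhammer (\<alpha> + 1 + real j) i)"
proof -
  have na: "\<alpha> + 1 \<notin> \<int>\<^sub>\<le>\<^sub>0" "\<beta> + 1 \<notin> \<int>\<^sub>\<le>\<^sub>0" using \<alpha>_gt \<beta>_gt by (auto simp: plus_one_in_nonpos_Ints_imp elim!: nonpos_Ints_cases)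
  have G: "Gamma (\<alpha> + 1) > 0" "Gamma (\<beta> + 1) > 0" using \<alpha>_gt \<beta>_gt by (auto intro!: Gamma_real_pos)
  have "Gamma (\<alpha> + 1 + real (i + j)) = Gamma (\<alpha> + 1) * pochhammer (\<alpha> + 1) (i + j)"
    using G by (subst pochhammer_Gamma[OF na(1)]) (simp add: add_ac)
  also have "pochhammer (\<alpha> + 1) (i + j) = pochhammer (\<alpha> + 1) j * pochhammer (\<alpha> + 1 + real j) i"
    by (subst pochhammer_product[of j]) auto
  finally have 1: "Gamma (\<alpha> + 1 + real (i + j)) = Gamma (\<alpha> + 1) * (pochhammer (\<alpha> + 1) j * pochhammer (\<alpha> + 1 + real j) i)" .
  have 2: "Gamma (\<beta> + 1 + real (n - j)) = Gamma (\<beta> + 1) * pochhammer (\<beta> + 1) (n - j)"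
    using G by (subst pochhammer_Gamma[OF na(2)]) simp
  have 3: "\<alpha> + 1 + real (i + j) + (\<beta> + 1 + real (n - j)) = \<alpha> + \<beta> + 2 + real (n + i)"
    using assms by (simp add: of_nat_diff)
  have "Beta (\<alpha> + 1 + real (i + j)) (\<beta> + 1 + real (n - j)) =
     Gamma (\<alpha> + 1) * (pochhammer (\<alpha> + 1) j * pochhammer (\<alpha> + 1 + real j) i)
       * (Gamma (\<beta> + 1) * pochhammer (\<beta> + 1) (n - j)) / Gamma (\<alpha> + \<beta> + 2 + real (n + i))"
    unfolding Beta_def 1 2 3 ..
  moreover have "real (n choose j) = fact n / (fact j * fact (n - j))"
    using assms by (simp add: binomial_fact)
  ultimately show ?thesis
    using pochhammer_parameter_pos(1)[of j] pochhammer_parameter_pos(2)[of "n - j"]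
    by (simp add: weight_coeff_def mult_ac)
qed

text \<open>One factor \<open>J n\<close> is expanded in powers x^i, the other in x^j (1-x)^(n-j).
  Orthogonality to lower powers leaves only i = n, so the norm is governed by the leading
  coefficient of \<open>J n\<close>.\<close>

lemma has_integral_J_square:
  "((\<lambda>x. x powr \<alpha> * (1 - x) powr \<beta> * (J n x)\<^sup>2) has_integral
     appell_form n 1 1 * (Gamma (\<alpha> + 1) * Gamma (\<beta> + 1) / Gamma (\<alpha> + \<beta> + 2 + 2 * real n))) {0<..<1}"
proof -
  define c where "c i = coeff (appell_poly n (-1) 1) i" for i
  define T where "T j = (-1) ^ j * weight_coeff j (n - j)" for j
  define K where "K = Gamma (\<alpha> + 1) * Gamma (\<beta> + 1) / (fact n * Gamma (\<alpha> + \<beta> + 2 + 2 * real n))"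
  have J1: "J n x = (\<Sum>i\<le>n. c i * x ^ i)" for x
  proof -
    have "degree (appell_poly n (-1) 1) \<le> n" by (intro degree_le) (auto simp: coeff_appell_poly)
    then show ?thesis unfolding poly_J c_def poly_altdef
      by (intro sum.mono_neutral_left) (auto simp: coeff_eq_0)
  qed
  have J2: "J n x = (\<Sum>j\<le>n. T j * (x ^ j * (1 - x) ^ (n - j)))" for x
    by (auto simp: J_def appell_form_def T_def power_minus[of x] intro!: sum.cong)
  have "((\<lambda>x. \<Sum>i\<le>n. \<Sum>j\<le>n. c i * T j * (x powr \<alpha> * (1 - x) powr \<beta> * (x ^ (i + j) * (1 - x) ^ (n - j))))
     has_integral (\<Sum>i\<le>n. \<Sum>j\<le>n. c i * T j * Beta (\<alpha> + 1 + real (i + j)) (\<beta> + 1 + real (n - j)))) {0<..<1}"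
    by (intro has_integral_sum has_integral_mult_right has_integral_beta_monomial) auto
  also have "(\<lambda>x. \<Sum>i\<le>n. \<Sum>j\<le>n. c i * T j * (x powr \<alpha> * (1 - x) powr \<beta> * (x ^ (i + j) * (1 - x) ^ (n - j))))
     = (\<lambda>x. x powr \<alpha> * (1 - x) powr \<beta> * (J n x)\<^sup>2)"
  proof
    fix x
    have "(J n x)\<^sup>2 = (\<Sum>i\<le>n. c i * x ^ i) * (\<Sum>j\<le>n. T j * (x ^ j * (1 - x) ^ (n - j)))"
      unfolding power2_eq_square by (subst J1, subst J2, rule refl)
    then have sq: "(J n x)\<^sup>2 = (\<Sum>i\<le>n. \<Sum>j\<le>n. c i * x ^ i * (T j * (x ^ j * (1 - x) ^ (n - j))))"
      unfolding sum_product .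
    show "(\<Sum>i\<le>n. \<Sum>j\<le>n. c i * T j * (x powr \<alpha> * (1 - x) powr \<beta> * (x ^ (i + j) * (1 - x) ^ (n - j))))
     = x powr \<alpha> * (1 - x) powr \<beta> * (J n x)\<^sup>2"
      unfolding sq sum_distrib_left by (intro sum.cong refl) (simp add: power_add mult_ac)
  qed
  also have "(\<Sum>i\<le>n. \<Sum>j\<le>n. c i * T j * Beta (\<alpha> + 1 + real (i + j)) (\<beta> + 1 + real (n - j)))
     = (\<Sum>i\<le>n. if i = n then c n * ((-1) ^ n * fact n * K) else 0)"
  proof (intro sum.cong refl)
    fix i assume "i \<in> {..n}"
    then have i: "i \<le> n" by simp
    have "(\<Sum>j\<le>n. c i * T j * Beta (\<alpha> + 1 + real (i + j)) (\<beta> + 1 + real (n - j)))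
      = (\<Sum>j\<le>n. c i * (-1) ^ j * (Gamma (\<alpha> + 1) * Gamma (\<beta> + 1) / (fact n * Gamma (\<alpha> + \<beta> + 2 + real (n + i))) *
      (real (n choose j) * pochhammer (\<alpha> + 1 + real j) i)))"
      by (intro sum.cong refl) (subst Beta_shift[symmetric], auto simp: T_def)
    also have "\<dots> = c i * (Gamma (\<alpha> + 1) * Gamma (\<beta> + 1) / (fact n * Gamma (\<alpha> + \<beta> + 2 + real (n + i))))
       * (\<Sum>j\<le>n. (-1) ^ j * real (n choose j) * pochhammer (\<alpha> + 1 + real j) i)"
      unfolding sum_distrib_left by (intro sum.cong refl) (simp only: mult_ac)
    also have "\<dots> = (if i = n then c n * ((-1) ^ n * fact n * K) else 0)"
    proof -
      have eq: "2 * real n = real (n + n)" by simp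
      then show ?thesis
        unfolding sum_alternating_binomial_pochhammer[OF i] K_def eq
        by (simp add: mult_ac del: of_nat_add)
    qed
    finally show "(\<Sum>j\<le>n. c i * T j * Beta (\<alpha> + 1 + real (i + j)) (\<beta> + 1 + real (n - j)))
      = (if i = n then c n * ((-1) ^ n * fact n * K) else 0)" .
  qed
  also have "\<dots> = c n * ((-1) ^ n * fact n * K)" by simp
  also have "\<dots> = appell_form n 1 1 * (fact n * K)"
    unfolding c_def coeff_J by (simp flip: power_add mult_2)
  also have "fact n * K = Gamma (\<alpha> + 1) * Gamma (\<beta> + 1) / Gamma (\<alpha> + \<beta> + 2 + 2 * real n)"
    by (simp add: K_def)
  finally show ?thesis .
qed

text \<open>The substitution x = sin^2 (\<theta>/2), dx = sin (\<theta>/2) cos (\<theta>/2)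
  d\<theta>. Nonnegativity upgrades the gauge integral to the absolute integrability that the change
  of variables asks for.\<close>

lemma integral_jacobi_measure:
  fixes f :: "real \<Rightarrow> real"
  assumes f: "f \<in> borel_measurable borel"
    and int: "((\<lambda>x. x powr \<alpha> * (1 - x) powr \<beta> * f x) has_integral I) {0<..<1}"
    and nonneg: "\<And>x. f x \<ge> 0"
  shows "(\<integral>\<theta>. f ((sin (\<theta> / 2))\<^sup>2) \<partial>jacobi_measure \<alpha> \<beta>) = I"
proof -
  define F where "F x = x powr \<alpha> * (1 - x) powr \<beta> * f x" for x
  define g where "g \<theta> = (sin (\<theta> / 2))\<^sup>2" for \<theta> :: real
  define w where "w \<theta> = sin (\<theta> / 2) powr (2 * \<alpha> + 1) * cos (\<theta> / 2) powr (2 * \<beta> + 1)" for \<theta> :: real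
  have half: "0 < sin (\<theta> / 2)" "0 < cos (\<theta> / 2)" if "\<theta> \<in> {0<..<pi}" for \<theta>
    using that by (auto intro!: sin_gt_zero cos_gt_zero)
  have wF: "\<bar>sin (\<theta> / 2) * cos (\<theta> / 2)\<bar> * F (g \<theta>) = w \<theta> * f (g \<theta>)" if "\<theta> \<in> {0<..<pi}" for \<theta>
  proof -
    have "(sin (\<theta> / 2))\<^sup>2 powr \<alpha> * sin (\<theta> / 2) = sin (\<theta> / 2) powr (2 * \<alpha> + 1)"
      using half[OF that] by (simp add: powr_add powr_powr flip: powr_numeral)
    moreover have "(1 - (sin (\<theta> / 2))\<^sup>2) powr \<beta> * cos (\<theta> / 2) = cos (\<theta> / 2) powr (2 * \<beta> + 1)"
      unfolding cos_squared_eq[symmetric]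
      using half[OF that] by (simp add: powr_add powr_powr flip: powr_numeral)
    moreover have "\<bar>sin (\<theta> / 2) * cos (\<theta> / 2)\<bar> * F (g \<theta>) = ((sin (\<theta> / 2))\<^sup>2 powr \<alpha> * sin (\<theta> / 2))
        * ((1 - (sin (\<theta> / 2))\<^sup>2) powr \<beta> * cos (\<theta> / 2)) * f (g \<theta>)"
      using half[OF that] by (simp add: F_def g_def abs_mult)
    ultimately show ?thesis by (simp add: w_def)
  qed
  have inj: "inj_on g {0<..<pi}"
  proof (rule strict_mono_on_imp_inj_on, rule strict_mono_onI)
    fix r s :: real assume "r \<in> {0<..<pi}" "s \<in> {0<..<pi}" "r < s"
    then show "g r < g s" unfolding g_def using half
      by (intro power_strict_mono sin_monotone_2pi) (auto simp: less_imp_le)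
  qed
  have img: "g ` {0<..<pi} = {0<..<1}"
  proof
    show "g ` {0<..<pi} \<subseteq> {0<..<1}"
    proof clarify
      fix \<theta> :: real assume \<theta>: "\<theta> \<in> {0<..<pi}"
      have "(cos (\<theta> / 2))\<^sup>2 > 0" "(sin (\<theta> / 2))\<^sup>2 > 0" using half[OF \<theta>] by simp_all
      then show "g \<theta> \<in> {0<..<1}"
        using sin_cos_squared_add[of "\<theta> / 2"] unfolding g_def greaterThanLessThan_iff by linarith
    qed
    show "{0<..<1} \<subseteq> g ` {0<..<pi}"
    proof
      fix x :: real assume x: "x \<in> {0<..<1}"
      then have sq: "0 < sqrt x" "sqrt x < 1" by auto
      have "arcsin 0 < arcsin (sqrt x)" "arcsin (sqrt x) < arcsin 1"
        by (rule arcsin_less_arcsin; use sq in linarith)+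
      then have "2 * arcsin (sqrt x) \<in> {0<..<pi}" by simp
      moreover have "g (2 * arcsin (sqrt x)) = x"
      proof -
        have "sin (arcsin (sqrt x)) = sqrt x" by (rule sin_arcsin) (use sq in linarith)+
        then show ?thesis using x by (simp add: g_def)
      qed
      ultimately show "x \<in> g ` {0<..<pi}" by (metis image_eqI)
    qed
  qed
  have dg: "(g has_field_derivative sin (\<theta> / 2) * cos (\<theta> / 2)) (at \<theta> within {0<..<pi})" for \<theta>
    unfolding g_def by (auto intro!: derivative_eq_intros)
  have "F absolutely_integrable_on {0<..<1}" unfolding F_def using int nonneg
    by (intro nonnegative_absolutely_integrable_1) (auto simp: has_integral_iff)
  moreover have "integral {0<..<1} F = I" using int by (simp add: F_def[abs_def] has_integral_iff)
  ultimately have "(\<lambda>\<theta>. \<bar>sin (\<theta> / 2) * cos (\<theta> / 2)\<bar> * F (g \<theta>)) absolutely_integrable_on {0<..<pi} \<and>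
     integral {0<..<pi} (\<lambda>\<theta>. \<bar>sin (\<theta> / 2) * cos (\<theta> / 2)\<bar> * F (g \<theta>)) = I"
    by (subst has_absolute_integral_change_of_variables_1'[OF _ dg inj]) (simp_all add: img)
  moreover have "(\<lambda>\<theta>. \<bar>sin (\<theta> / 2) * cos (\<theta> / 2)\<bar> * F (g \<theta>)) absolutely_integrable_on {0<..<pi}
      \<longleftrightarrow> (\<lambda>\<theta>. w \<theta> * f (g \<theta>)) absolutely_integrable_on {0<..<pi}"
    by (rule set_integrable_cong; (rule refl | erule wF))
  moreover have "integral {0<..<pi} (\<lambda>\<theta>. \<bar>sin (\<theta> / 2) * cos (\<theta> / 2)\<bar> * F (g \<theta>))
      = integral {0<..<pi} (\<lambda>\<theta>. w \<theta> * f (g \<theta>))"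
    by (rule Henstock_Kurzweil_Integration.integral_cong) (erule wF)
  ultimately have ai: "(\<lambda>\<theta>. w \<theta> * f (g \<theta>)) absolutely_integrable_on {0<..<pi}"
     and I: "integral {0<..<pi} (\<lambda>\<theta>. w \<theta> * f (g \<theta>)) = I"
    by simp_all
  have [measurable]: "(\<lambda>\<theta>. f (g \<theta>)) \<in> borel_measurable borel" "w \<in> borel_measurable borel"
    using f unfolding g_def w_def by measurable
  have "(\<integral>\<theta>. f (g \<theta>) \<partial>jacobi_measure \<alpha> \<beta>) = (\<integral>\<theta>. w \<theta> * f (g \<theta>) \<partial>restrict_space lborel {0<..<pi})"
    unfolding jacobi_measure_def
    by (subst integral_real_density)
      (auto simp: w_def[symmetric] space_restrict_space intro!: AE_I2 measurable_restrict_space1, auto simp: w_def)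
  also have "\<dots> = (LINT \<theta>:{0<..<pi}|lborel. w \<theta> * f (g \<theta>))"
    unfolding set_lebesgue_integral_def by (subst integral_restrict_space) auto
  also have "\<dots> = (LINT \<theta>:{0<..<pi}|lebesgue. w \<theta> * f (g \<theta>))"
    unfolding set_lebesgue_integral_def by (subst integral_completion) auto
  also have "\<dots> = I"
    using set_lebesgue_integral_eq_integral(2)[OF ai] I by simp
  finally show ?thesis by (simp add: g_def)
qed

lemma integral_J_square:
  "(\<integral>\<theta>. (J n ((sin (\<theta> / 2))\<^sup>2))\<^sup>2 \<partial>jacobi_measure \<alpha> \<beta>)
     = appell_form n 1 1 * (Gamma (\<alpha> + 1) * Gamma (\<beta> + 1) / Gamma (\<alpha> + \<beta> + 2 + 2 * real n))"
  by (rule integral_jacobi_measure[OF _ has_integral_J_square]) (auto simp: J_def appell_form_def)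

text \<open>The case n = 0 of the norm, as \<open>J 0\<close> is the constant 1.\<close>

lemma measure_jacobi_measure:
  "measure (jacobi_measure \<alpha> \<beta>) {0<..<pi} = Beta (\<alpha> + 1) (\<beta> + 1)"
proof -
  have "space (jacobi_measure \<alpha> \<beta>) = {0<..<pi}"
    by (simp add: jacobi_measure_def space_restrict_space)
  moreover have "J 0 x = 1" for x by (simp add: J_def appell_form_def weight_coeff_def)
  moreover have "appell_form 0 1 1 = 1" by (simp add: appell_form_def weight_coeff_def)
  ultimately show ?thesis
    using integral_J_square[of 0] by (simp add: Beta_def add_ac)
qed

text \<open>Only the square of the normalising constant enters, so the root disappears and the
  factor between \<open>jacobi_P\<close> and \<open>J\<close> cancels. The norm is written with Beta
  to isolate the total mass of the measure.\<close>

lemma jacobi_trig_product: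
  assumes "\<theta> \<in> {0<..<pi}" "\<phi> \<in> {0<..<pi}"
  shows "jacobi_trig n \<alpha> \<beta> \<theta> * jacobi_trig n \<alpha> \<beta> \<phi> =
    pochhammer (\<alpha> + \<beta> + 2) (2 * n) / (Beta (\<alpha> + 1) (\<beta> + 1) * appell_form n 1 1) *
      (J n ((sin (\<theta> / 2))\<^sup>2) * J n ((sin (\<phi> / 2))\<^sup>2))"
proof -
  define P where "P = pochhammer (\<alpha> + 1) n * pochhammer (\<beta> + 1) n"
  define h where "h = appell_form n 1 1 * (Gamma (\<alpha> + 1) * Gamma (\<beta> + 1) / Gamma (\<alpha> + \<beta> + 2 + 2 * real n))"
  have P: "P > 0" using pochhammer_parameter_pos by (simp add: P_def)
  have G: "Gamma (\<alpha> + 1) > 0" "Gamma (\<beta> + 1) > 0" "Gamma (\<alpha> + \<beta> + 2) > 0"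
     "Gamma (\<alpha> + \<beta> + 2 + 2 * real n) > 0"
    using \<alpha>_gt \<beta>_gt by (auto intro!: Gamma_real_pos)
  have h: "h > 0" using G appell_form_one_pos by (simp add: h_def)
  have eq: "jacobi_P n \<alpha> \<beta> (cos x) = P * J n ((sin (x / 2))\<^sup>2)" if "x \<in> {0<..<pi}" for x
  proof -
    have "-1 < cos x" "cos x < 1"
      using that cos_monotone_0_pi[of x pi] cos_monotone_0_pi[of 0 x] by auto
    moreover have "(1 - cos x) / 2 = (sin (x / 2))\<^sup>2"
      using cos_double_sin[of "x / 2"] by simp
    ultimately show ?thesis by (simp add: jacobi_P_eq_J P_def)
  qed
  have "(\<integral>x. (jacobi_P n \<alpha> \<beta> (cos x))\<^sup>2 \<partial>jacobi_measure \<alpha> \<beta>)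
     = (\<integral>x. P\<^sup>2 * (J n ((sin (x / 2))\<^sup>2))\<^sup>2 \<partial>jacobi_measure \<alpha> \<beta>)"
    by (intro Bochner_Integration.integral_cong refl)
       (simp add: jacobi_measure_def space_restrict_space eq power_mult_distrib)
  also have "\<dots> = P\<^sup>2 * h"
    by (simp add: integral_J_square h_def)
  finally have "(jacobi_c n \<alpha> \<beta>)\<^sup>2 = 1 / (P\<^sup>2 * h)"
    using h by (simp add: jacobi_c_def power_inverse inverse_eq_divide power_divide del: real_sqrt_mult)
  moreover have "jacobi_trig n \<alpha> \<beta> \<theta> * jacobi_trig n \<alpha> \<beta> \<phi> = (jacobi_c n \<alpha> \<beta>)\<^sup>2 * P\<^sup>2 *
     (J n ((sin (\<theta> / 2))\<^sup>2) * J n ((sin (\<phi> / 2))\<^sup>2))"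
    unfolding jacobi_trig_def eq[OF assms(1)] eq[OF assms(2)]
      power2_eq_square[of P] power2_eq_square[of "jacobi_c n \<alpha> \<beta>"]
    by (simp add: mult_ac)
  ultimately have "jacobi_trig n \<alpha> \<beta> \<theta> * jacobi_trig n \<alpha> \<beta> \<phi> = 1 / h *
     (J n ((sin (\<theta> / 2))\<^sup>2) * J n ((sin (\<phi> / 2))\<^sup>2))"
    using P by simp
  also have "1 / h = pochhammer (\<alpha> + \<beta> + 2) (2 * n) / (Beta (\<alpha> + 1) (\<beta> + 1) * appell_form n 1 1)"
  proof -
    have "\<alpha> + \<beta> + 2 \<notin> \<int>\<^sub>\<le>\<^sub>0" using \<alpha>_gt \<beta>_gt by (auto elim!: nonpos_Ints_cases)
    then have "pochhammer (\<alpha> + \<beta> + 2) (2 * n) = Gamma (\<alpha> + \<beta> + 2 + 2 * real n) / Gamma (\<alpha> + \<beta> + 2)"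
      by (simp add: pochhammer_Gamma)
    moreover have "Beta (\<alpha> + 1) (\<beta> + 1) = Gamma (\<alpha> + 1) * Gamma (\<beta> + 1) / Gamma (\<alpha> + \<beta> + 2)"
      by (simp add: Beta_def add_ac)
    ultimately show ?thesis using G by (simp add: h_def)
  qed
  finally show ?thesis .
qed

end

subsection \<open>Series\<close>

text \<open>The operator z d/dz on power series; \<open>diffs\<close> alone is d/dz.\<close>

lemma sums_diffs_shift:
  fixes c :: "nat \<Rightarrow> real"
  assumes "summable (\<lambda>n. diffs c n * z ^ n)"
  shows "(\<lambda>n. (real n * c n) * z ^ n) sums (z * (\<Sum>n. diffs c n * z ^ n))"
proof -
  have "(\<lambda>n. (real (Suc n) * c (Suc n)) * z ^ Suc n) sums (z * (\<Sum>n. diffs c n * z ^ n))"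
    using sums_mult[OF summable_sums[OF assms], of z] by (simp add: diffs_def mult_ac)
  then show ?thesis by (subst (asm) sums_Suc_iff) simp
qed

lemma power_mult_powr: "0 < z \<Longrightarrow> z ^ n * z powr a = z powr (a + real n)" for z a :: real
  by (simp add: powr_add powr_realpow)

text \<open>The coefficient is the binomial coefficient of 2k + \<nu> over k, and the sum is the
  classical B(z)^\<nu> / sqrt (1 - 4z) with the Catalan generating function B. The parametrisation z
  = x / (1 + x)^2 makes both explicit: B(z) = 1 + x and sqrt (1 - 4z) = (1 - x) / (1 + x).\<close>

lemma sums_central_pochhammer:
  fixes \<nu> x :: real
  assumes \<nu>: "-1 < \<nu>" and x: "0 < x" "x < 1"
  shows "(\<lambda>k. pochhammer (\<nu> + 1 + real k) k / fact k * (x / (1 + x)\<^sup>2) ^ k)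
           sums ((1 + x) powr (\<nu> + 1) / (1 - x))"
proof -
  define c where "c k = pochhammer (\<nu> + 1 + real k) k / fact k" for k
  have c_pos: "c k > 0" for k unfolding c_def using \<nu> by (auto intro!: pochhammer_pos divide_pos_pos)
  \<comment> \<open>This recurrence yields both the radius of convergence 1/4 and the hypergeometric
    equation \<open>ode\<close>, in which the index k becomes z d/dz.\<close>
  have c_Suc: "real (Suc k) * (\<nu> + 1 + real k) * c (Suc k) =
      (\<nu> + 1 + 2 * real k) * (\<nu> + 2 + 2 * real k) * c k" for k
  proof -
    have "(\<nu> + 1 + real k) * pochhammer (\<nu> + 1 + real (Suc k)) (Suc k)
        = pochhammer (\<nu> + 1 + real k) (Suc (Suc k))"
      by (subst (2) pochhammer_rec) (simp add: add_ac)
    also have "\<dots> = pochhammer (\<nu> + 1 + real k) k * ((\<nu> + 1 + 2 * real k) * (\<nu> + 2 + 2 * real k))"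
      by (simp add: pochhammer_Suc mult_ac add_ac)
    finally have *: "(\<nu> + 1 + real k) * pochhammer (\<nu> + 1 + real (Suc k)) (Suc k) =
      pochhammer (\<nu> + 1 + real k) k * ((\<nu> + 1 + 2 * real k) * (\<nu> + 2 + 2 * real k))" .
    have "real (Suc k) * c (Suc k) = pochhammer (\<nu> + 1 + real (Suc k)) (Suc k) / fact k"
      by (simp add: c_def del: of_nat_Suc)
    then have "real (Suc k) * (\<nu> + 1 + real k) * c (Suc k) =
       (\<nu> + 1 + real k) * pochhammer (\<nu> + 1 + real (Suc k)) (Suc k) / fact k"
      by (metis mult.assoc mult.commute times_divide_eq_right)
    then show ?thesis unfolding * c_def by simp
  qed
  have "conv_radius c = ereal (1 / 4)"
  proof (rule conv_radius_ratio_limit_nonzero[OF refl])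
    have "norm (c k) / norm (c (Suc k)) =
       real (Suc k) * (\<nu> + 1 + real k) / ((\<nu> + 1 + 2 * real k) * (\<nu> + 2 + 2 * real k))" for k
    proof -
      have "(\<nu> + 1 + 2 * real k) * (\<nu> + 2 + 2 * real k) > 0" using \<nu> by (intro mult_pos_pos) auto
      then show ?thesis using c_Suc[of k] c_pos[of k] c_pos[of "Suc k"]
        by (simp add: field_simps)
    qed
    moreover have "(\<lambda>k. real (Suc k) * (\<nu> + 1 + real k) / ((\<nu> + 1 + 2 * real k) * (\<nu> + 2 + 2 * real k)))
       \<longlonglongrightarrow> 1 / 4" by real_asymp
    ultimately show "(\<lambda>k. norm (c k) / norm (c (Suc k))) \<longlonglongrightarrow> 1 / 4" by simp
  qed simp
  then have s0: "summable (\<lambda>n. c n * z ^ n)" if "norm z < 1 / 4" for z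
    using that by (intro summable_in_conv_radius) simp
  have s1: "summable (\<lambda>n. diffs c n * z ^ n)" if "norm z < 1 / 4" for z
    using termdiff_converges[OF that s0] by simp
  have s2: "summable (\<lambda>n. diffs (diffs c) n * z ^ n)" if "norm z < 1 / 4" for z
    using termdiff_converges[OF that s1] by simp
  define A where "A z = (\<Sum>n. c n * z ^ n)" for z
  define A1 where "A1 z = (\<Sum>n. diffs c n * z ^ n)" for z
  define A2 where "A2 z = (\<Sum>n. diffs (diffs c) n * z ^ n)" for z
  have dA: "(A has_field_derivative A1 z) (at z)" if "norm z < 1 / 4" for z
    using termdiffs_strong'[OF s0 that] by (simp add: A_def[abs_def] A1_def)
  have dA1: "(A1 has_field_derivative A2 z) (at z)" if "norm z < 1 / 4" for z
    using termdiffs_strong'[OF s1 that] by (simp add: A1_def[abs_def] A2_def)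
  have ode: "z * (1 - 4 * z) * A2 z + (1 + \<nu> - (4 * \<nu> + 10) * z) * A1 z = (\<nu> + 1) * (\<nu> + 2) * A z"
    if z: "norm z < 1 / 4" for z
  proof -
    have a0: "(\<lambda>n. c n * z ^ n) sums A z" unfolding A_def using s0[OF z] by (rule summable_sums)
    have a1: "(\<lambda>n. diffs c n * z ^ n) sums A1 z" unfolding A1_def using s1[OF z] by (rule summable_sums)
    have a1': "(\<lambda>n. (real n * c n) * z ^ n) sums (z * A1 z)"
      unfolding A1_def by (rule sums_diffs_shift[OF s1[OF z]])
    have a2: "(\<lambda>n. (real n * diffs c n) * z ^ n) sums (z * A2 z)"
      unfolding A2_def by (rule sums_diffs_shift[OF s2[OF z]])
    have "(\<lambda>n. (real (Suc n) * (real (Suc n) - 1) * c (Suc n)) * z ^ Suc n) sums (z * (z * A2 z))"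
      using sums_mult[OF a2, of z] by (simp add: diffs_def mult_ac)
    then have a2': "(\<lambda>n. (real n * (real n - 1) * c n) * z ^ n) sums (z * (z * A2 z))"
      by (subst (asm) sums_Suc_iff) simp
    have "(\<lambda>n. real n * diffs c n * z ^ n - 4 * ((real n * (real n - 1) * c n) * z ^ n)
        + (1 + \<nu>) * (diffs c n * z ^ n) - (4 * \<nu> + 10) * ((real n * c n) * z ^ n)
        - (\<nu> + 1) * (\<nu> + 2) * (c n * z ^ n)) sums
      (z * A2 z - 4 * (z * (z * A2 z)) + (1 + \<nu>) * A1 z - (4 * \<nu> + 10) * (z * A1 z)
        - (\<nu> + 1) * (\<nu> + 2) * A z)"
      by (intro sums_add sums_diff sums_mult a0 a1 a1' a2 a2')
    moreover have "real n * diffs c n * z ^ n - 4 * ((real n * (real n - 1) * c n) * z ^ n)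
        + (1 + \<nu>) * (diffs c n * z ^ n) - (4 * \<nu> + 10) * ((real n * c n) * z ^ n)
        - (\<nu> + 1) * (\<nu> + 2) * (c n * z ^ n) = 0" (is "?T n = 0") for n
    proof -
      have "?T n = (real (Suc n) * (\<nu> + 1 + real n) * c (Suc n)
        - (\<nu> + 1 + 2 * real n) * (\<nu> + 2 + 2 * real n) * c n) * z ^ n"
        by (simp add: diffs_def algebra_simps)
      then show ?thesis unfolding c_Suc by simp
    qed
    ultimately have "(\<lambda>n. 0) sums (z * A2 z - 4 * (z * (z * A2 z)) + (1 + \<nu>) * A1 z - (4 * \<nu> + 10) * (z * A1 z)
        - (\<nu> + 1) * (\<nu> + 2) * A z)" by simp
    then have "z * A2 z - 4 * (z * (z * A2 z)) + (1 + \<nu>) * A1 z - (4 * \<nu> + 10) * (z * A1 z)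
        - (\<nu> + 1) * (\<nu> + 2) * A z = 0"
      using sums_unique2 sums_zero by blast
    then show ?thesis by (simp add: algebra_simps)
  qed
  define Z where "Z y = y / (1 + y)\<^sup>2" for y :: real
  \<comment> \<open>The value 1/4 would be reached only at y = 1, so the whole range of y stays
    inside the disc of convergence.\<close>
  have Z_less: "norm (Z y) < 1 / 4" if "0 \<le> y" "y < 1" for y
  proof -
    have "(1 - y)\<^sup>2 > 0" using that by simp
    then have "4 * y < (1 + y)\<^sup>2" by (simp add: power2_eq_square algebra_simps)
    then show ?thesis using that by (simp add: Z_def field_simps)
  qed
  have dZ: "(Z has_field_derivative (1 - y) / (1 + y) ^ 3) (at y)" if "0 \<le> y" for y
    unfolding Z_def using that
    by (auto intro!: derivative_eq_intros simp: divide_simps) (simp add: eval_nat_numeral algebra_simps)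
  have dAZ: "((\<lambda>y. A (Z y)) has_field_derivative A1 (Z y) * ((1 - y) / (1 + y) ^ 3)) (at y)"
    and dA1Z: "((\<lambda>y. A1 (Z y)) has_field_derivative A2 (Z y) * ((1 - y) / (1 + y) ^ 3)) (at y)"
    if "0 \<le> y" "y < 1" for y
    using DERIV_chain2[OF dA[OF Z_less[OF that]] dZ] DERIV_chain2[OF dA1[OF Z_less[OF that]] dZ] that by auto
  text \<open>Reduction of order: \<open>U\<close> is the quotient of the series by the claimed sum, and \<open>\<Phi>\<close> is \<open>U'\<close> times
    the inverse of the Wronskian weight, hence constant by the differential equation for \<open>A\<close>. It
    vanishes at \<open>0\<close>, so \<open>U\<close> is constant.\<close>
  define U where "U y = (1 - y) * (1 + y) powr (- (\<nu> + 1)) * A (Z y)" for y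
  define V where "V y = (\<nu> * y - \<nu> - 2) * (1 + y)\<^sup>2 * A (Z y) + (1 - y)\<^sup>2 * A1 (Z y)" for y
  define \<Phi> where "\<Phi> y = y powr (\<nu> + 1) * ((1 + y) powr (- (\<nu> + 4)) * V y)" for y
  have dU: "(U has_field_derivative (1 + y) powr (- (\<nu> + 4)) * V y) (at y)" if y: "0 \<le> y" "y < 1" for y
  proof -
    \<comment> \<open>Every power of 1 + y is brought to the exponent -(\<nu> + 4); what remains to
      be checked is rational in y.\<close>
    have p: "(1 + y) powr (- (\<nu> + 1)) = (1 + y) ^ 3 * (1 + y) powr (- (\<nu> + 4))"
       "(1 + y) powr (- (\<nu> + 1) - 1) = (1 + y) ^ 2 * (1 + y) powr (- (\<nu> + 4))"
      using y by (simp_all add: power_mult_powr minus_diff_commute)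
    have "(U has_field_derivative
        ((- 1) * (1 + y) powr (- (\<nu> + 1)) + (1 - y) * (- (\<nu> + 1) * (1 + y) powr (- (\<nu> + 1) - 1))) * A (Z y)
        + (1 - y) * (1 + y) powr (- (\<nu> + 1)) * (A1 (Z y) * ((1 - y) / (1 + y) ^ 3))) (at y)"
      unfolding U_def using y
      by (auto intro!: derivative_eq_intros dAZ simp: mult_ac)
    also have "((- 1) * (1 + y) powr (- (\<nu> + 1)) + (1 - y) * (- (\<nu> + 1) * (1 + y) powr (- (\<nu> + 1) - 1))) * A (Z y)
        + (1 - y) * (1 + y) powr (- (\<nu> + 1)) * (A1 (Z y) * ((1 - y) / (1 + y) ^ 3))
        = (1 + y) powr (- (\<nu> + 4)) * V y"
      unfolding p V_def using y by (simp add: field_simps) (simp add: eval_nat_numeral algebra_simps)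
    finally show ?thesis .
  qed
  have d\<Phi>: "(\<Phi> has_field_derivative 0) (at y)" if y: "0 < y" "y < 1" for y
  proof -
    define w where "w = (1 - y) / (1 + y) ^ 3"
    have dV: "(V has_field_derivative
       \<nu> * (1 + y)\<^sup>2 * A (Z y) + (\<nu> * y - \<nu> - 2) * (2 * (1 + y)) * A (Z y)
       + (\<nu> * y - \<nu> - 2) * (1 + y)\<^sup>2 * (A1 (Z y) * w)
       - 2 * (1 - y) * A1 (Z y) + (1 - y)\<^sup>2 * (A2 (Z y) * w)) (at y)" (is "(V has_field_derivative ?dV) _")
      unfolding V_def w_def using y
      by (auto intro!: derivative_eq_intros dAZ dA1Z simp: algebra_simps)
    have p: "(\<nu> + 1) * y powr (\<nu> + 1 - 1) = (\<nu> + 1) * y powr \<nu>" "y powr (\<nu> + 1) = y * y powr \<nu>"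
       "(1 + y) powr (- (\<nu> + 4)) = (1 + y) * (1 + y) powr (- (\<nu> + 5))"
       "(1 + y) powr (- (\<nu> + 4) - 1) = (1 + y) powr (- (\<nu> + 5))"
      using y power_mult_powr[of y 1 \<nu>] power_mult_powr[of "1 + y" 1 "- (\<nu> + 5)"] by (simp_all add: add.commute)
    have "(\<Phi> has_field_derivative
       ((\<nu> + 1) * y powr (\<nu> + 1 - 1)) * ((1 + y) powr (- (\<nu> + 4)) * V y) +
       y powr (\<nu> + 1) * ((- (\<nu> + 4) * (1 + y) powr (- (\<nu> + 4) - 1)) * V y + (1 + y) powr (- (\<nu> + 4)) * ?dV)) (at y)"
      unfolding \<Phi>_def using y by (auto intro!: derivative_eq_intros dV)
    also have "((\<nu> + 1) * y powr (\<nu> + 1 - 1)) * ((1 + y) powr (- (\<nu> + 4)) * V y) +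
       y powr (\<nu> + 1) * ((- (\<nu> + 4) * (1 + y) powr (- (\<nu> + 4) - 1)) * V y + (1 + y) powr (- (\<nu> + 4)) * ?dV)
       = y powr \<nu> * (1 + y) powr (- (\<nu> + 5)) * (((\<nu> + 1) * (1 + y) - (\<nu> + 4) * y) * V y + y * (1 + y) * ?dV)"
      unfolding p by (simp add: algebra_simps)
    also have "((\<nu> + 1) * (1 + y) - (\<nu> + 4) * y) * V y + y * (1 + y) * ?dV = 0"
    proof -
      define z where "z = Z y"
      have zy: "z * (1 + y)\<^sup>2 = y" using y by (simp add: z_def Z_def)
      have wy: "w * (1 + y) ^ 3 = 1 - y" using y by (simp add: w_def)
      have y1: "1 + y \<noteq> 0" using y by simp
      have O: "z * (1 - 4 * z) * A2 z + (1 + \<nu> - (4 * \<nu> + 10) * z) * A1 z = (\<nu> + 1) * (\<nu> + 2) * A z"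
        unfolding z_def using y by (intro ode Z_less) auto
      have w': "w = (1 - y) / (1 + y) ^ 3" and z': "z = y / (1 + y)\<^sup>2" by (simp_all add: w_def z_def Z_def)
      \<comment> \<open>Since 1 - 4z = ((1 - y) / (1 + y))^2, the coefficient of \<open>A2\<close>
        is a multiple of the leading coefficient of \<open>ode\<close>, so the second derivative can
        be eliminated.\<close>
      have e1: "y * (1 + y) * ((1 - y)\<^sup>2 * w) = (1 - y) * (1 + y)\<^sup>2 * (z * (1 - 4 * z))"
        unfolding w' z' using y1
        by (simp add: divide_simps) (simp add: eval_nat_numeral algebra_simps)
      have "y * (1 + y) * ((1 - y)\<^sup>2 * (A2 z * w)) = (1 - y) * (1 + y)\<^sup>2 * (z * (1 - 4 * z) * A2 z)"
        using arg_cong[OF e1, of "\<lambda>t. t * A2 z"] by (simp add: mult_ac)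
      also have "z * (1 - 4 * z) * A2 z = (\<nu> + 1) * (\<nu> + 2) * A z - (1 + \<nu> - (4 * \<nu> + 10) * z) * A1 z"
        using O by simp
      finally have e2: "y * (1 + y) * ((1 - y)\<^sup>2 * (A2 z * w)) =
        (1 - y) * (1 + y)\<^sup>2 * ((\<nu> + 1) * (\<nu> + 2) * A z - (1 + \<nu> - (4 * \<nu> + 10) * z) * A1 z)" .
      have e3: "(1 - y) * (1 + y)\<^sup>2 * (1 + \<nu> - (4 * \<nu> + 10) * z) = (1 - y) * ((1 + \<nu>) * (1 + y)\<^sup>2 - (4 * \<nu> + 10) * y)"
        by (subst (3) zy[symmetric]) (simp add: algebra_simps)
      have e4: "y * (1 + y) * ((1 + y)\<^sup>2 * w) = y * (1 - y)"
        by (subst wy[symmetric]) (simp add: eval_nat_numeral)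
      have "((\<nu> + 1) * (1 + y) - (\<nu> + 4) * y) * V y + y * (1 + y) * ?dV =
        ((\<nu> + 1) * (1 + y) - (\<nu> + 4) * y) * ((\<nu> * y - \<nu> - 2) * (1 + y)\<^sup>2 * A z + (1 - y)\<^sup>2 * A1 z)
        + y * (1 + y) * (\<nu> * (1 + y)\<^sup>2 + (\<nu> * y - \<nu> - 2) * (2 * (1 + y))) * A z
        + (\<nu> * y - \<nu> - 2) * (y * (1 + y) * ((1 + y)\<^sup>2 * w)) * A1 z
        - 2 * (y * (1 + y)) * (1 - y) * A1 z + y * (1 + y) * ((1 - y)\<^sup>2 * (A2 z * w))"
        unfolding V_def z_def[symmetric] by (simp add: algebra_simps)
      also have "\<dots> = ((\<nu> + 1) * (1 + y) - (\<nu> + 4) * y) * ((\<nu> * y - \<nu> - 2) * (1 + y)\<^sup>2 * A z + (1 - y)\<^sup>2 * A1 z)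
        + y * (1 + y) * (\<nu> * (1 + y)\<^sup>2 + (\<nu> * y - \<nu> - 2) * (2 * (1 + y))) * A z
        + (\<nu> * y - \<nu> - 2) * (y * (1 - y)) * A1 z
        - 2 * (y * (1 + y)) * (1 - y) * A1 z
        + (1 - y) * (1 + y)\<^sup>2 * (\<nu> + 1) * (\<nu> + 2) * A z
        - ((1 - y) * (1 + y)\<^sup>2 * (1 + \<nu> - (4 * \<nu> + 10) * z)) * A1 z"
        unfolding e2 e4 by (simp add: algebra_simps)
      also have "\<dots> = 0" unfolding e3 by (simp add: eval_nat_numeral algebra_simps)
      finally show ?thesis .
    qed
    finally show ?thesis by simp
  qed
  have "\<Phi> y = 0" if y: "0 < y" "y < 1" for y
  proof -
    have c: "continuous_on {0..y} (\<lambda>y. A (Z y))" "continuous_on {0..y} (\<lambda>y. A1 (Z y))"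
      by (rule continuous_at_imp_continuous_on, rule ballI, rule DERIV_isCont, rule dAZ dA1Z; use y in simp)+
    \<comment> \<open>The exponent is positive because \<nu> > -1, so continuity extends to 0,
      although the derivative of \<Phi> is known only for y > 0.\<close>
    have "continuous_on {0..y} (\<lambda>y. y powr (\<nu> + 1))"
      by (rule continuous_on_powr') (use \<nu> in \<open>auto intro: continuous_intros\<close>)
    moreover have "continuous_on {0..y} (\<lambda>y. (1 + y) powr (- (\<nu> + 4)))"
      by (rule continuous_on_powr') (auto intro!: continuous_intros)
    moreover have "continuous_on {0..y} V"
      unfolding V_def by (intro continuous_intros c)
    ultimately have "continuous_on {0..y} \<Phi>"
      unfolding \<Phi>_def by (intro continuous_on_mult)
    then have "\<Phi> y = \<Phi> 0"
      by (rule DERIV_isconst_end[OF y(1)]) (use y d\<Phi> in auto)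
    then show ?thesis using \<nu> by (simp add: \<Phi>_def)
  qed
  then have V0: "V y = 0" if "0 < y" "y < 1" for y using that by (force simp: \<Phi>_def)
  have "U x = U 0"
  proof (rule DERIV_isconst_end[OF x(1)])
    show "continuous_on {0..x} U"
      by (rule continuous_at_imp_continuous_on, rule ballI, rule DERIV_isCont, rule dU; use x in simp)
    fix y assume "0 < y" "y < x"
    then show "(U has_real_derivative 0) (at y)" using dU[of y] V0[of y] x by simp
  qed
  also have "U 0 = 1"
    unfolding U_def Z_def A_def by (simp add: powser_zero) (simp add: c_def)
  finally have "A (Z x) = (1 + x) powr (\<nu> + 1) / (1 - x)"
    using x unfolding U_def powr_minus_divide by (simp add: field_simps)
  then show ?thesis
    using summable_sums[OF s0[OF Z_less[of x]]] x by (simp add: A_def Z_def c_def)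
qed

text \<open>The preceding sum at x = exp (-t), where 2 cosh (t/2) = exp (t/2) (1 + x) and 2 sinh
  (t/2) = exp (t/2) (1 - x).\<close>

lemma sums_pochhammer_cosh:
  fixes \<nu> t :: real
  assumes "-1 < \<nu>" "0 < t"
  shows "(\<lambda>k. pochhammer (\<nu> + 1 + real k) k / fact k * (2 * cosh (t / 2)) powr (- (\<nu> + 1 + 2 * real k)))
           sums (exp (- t * \<nu> / 2) / (2 * sinh (t / 2)))"
proof -
  define x where "x = exp (- t)"
  have x: "0 < x" "x < 1" using assms by (simp_all add: x_def)
  define C where "C = 2 * cosh (t / 2)"
  have C: "C > 0" by (simp add: C_def)
  have Cx: "C = exp (t / 2) * (1 + x)"
    by (simp add: C_def cosh_def x_def ring_distribs flip: exp_add)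
  have Sx: "2 * sinh (t / 2) = exp (t / 2) * (1 - x)"
    by (simp add: sinh_def x_def ring_distribs flip: exp_add)
  have "1 / C ^ 2 = x / (1 + x)\<^sup>2"
  proof -
    have "exp (t / 2) ^ 2 = 1 / x" by (simp add: x_def exp_minus field_simps flip: exp_double)
    then show ?thesis unfolding Cx power_mult_distrib by simp
  qed
  then have z: "C powr (- (\<nu> + 1 + 2 * real k)) = C powr (- (\<nu> + 1)) * (x / (1 + x)\<^sup>2) ^ k" for k
  proof -
    have "C powr (2 * real k) = C ^ (2 * k)" using C by (simp flip: powr_realpow)
    moreover have "C powr (- (\<nu> + 1 + 2 * real k)) = C powr (- (\<nu> + 1)) / C powr (2 * real k)"
      by (simp flip: powr_diff)
    ultimately show ?thesis by (simp add: power_mult power_one_over flip: \<open>1 / C ^ 2 = x / (1 + x)\<^sup>2\<close>)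
  qed
  have "C powr (- (\<nu> + 1)) * ((1 + x) powr (\<nu> + 1) / (1 - x)) = exp (- t * \<nu> / 2) / (2 * sinh (t / 2))"
  proof -
    have "C powr (- (\<nu> + 1)) = exp (- t * (\<nu> + 1) / 2) * (1 + x) powr (- (\<nu> + 1))"
      unfolding Cx using x by (subst powr_mult) (auto simp: powr_def field_simps)
    moreover have "exp (- t * (\<nu> + 1) / 2) = exp (- t * \<nu> / 2) / exp (t / 2)"
      by (simp add: field_simps flip: exp_add)
    moreover have "(1 + x) powr (- (\<nu> + 1)) * (1 + x) powr (\<nu> + 1) = 1"
      using x by (simp flip: powr_add)
    ultimately have "C powr (- (\<nu> + 1)) * (1 + x) powr (\<nu> + 1) = exp (- t * \<nu> / 2) / exp (t / 2)"
      by simp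
    then show ?thesis unfolding Sx using x by (simp add: field_simps)
  qed
  then show ?thesis
    using sums_mult[OF sums_central_pochhammer[OF assms(1) x], of "C powr (- (\<nu> + 1))"]
    unfolding C_def[symmetric] z by (simp add: mult_ac)
qed

lemma sums_negative_binomial:
  fixes z C \<sigma> :: real
  assumes "\<bar>z\<bar> < C"
  shows "(\<lambda>n. pochhammer \<sigma> n / fact n * z ^ n * C powr (- \<sigma> - real n)) sums (1 / (C - z) powr \<sigma>)"
proof -
  have "((- \<sigma>) gchoose n) * (- z) ^ n = pochhammer \<sigma> n / fact n * z ^ n" for n
  proof -
    have "((- \<sigma>) gchoose n) * (- z) ^ n = ((-1) ^ n * (-1) ^ n) * (pochhammer \<sigma> n / fact n * z ^ n)"
      unfolding gbinomial_pochhammer power_minus[of z] by simp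
    also have "(-1 :: real) ^ n * (-1) ^ n = 1"
      by (simp flip: power_mult_distrib)
    finally show ?thesis by simp
  qed
  then show ?thesis
    using gen_binomial_real'[of "- z" C "- \<sigma>"] assms by (simp add: powr_minus divide_inverse)
qed

text \<open>Fubini along n + k = p. Absolute convergence is demanded in blocks of constant p because
  the expansion of the integral delivers it in that form.\<close>

lemma infsum_antidiagonal:
  fixes f :: "nat \<Rightarrow> nat \<Rightarrow> real"
  assumes "summable (\<lambda>p. \<Sum>n\<le>p. \<bar>f n (p - n)\<bar>)"
  shows "(\<Sum>\<^sub>\<infinity>n. \<Sum>\<^sub>\<infinity>k. f n k) = (\<Sum>p. \<Sum>n\<le>p. f n (p - n))"
proof -
  let ?g = "\<lambda>(p, n). (n, p - n)" and ?S = "SIGMA p:UNIV. {..p}"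
  have bij: "bij_betw ?g ?S (UNIV \<times> UNIV :: (nat \<times> nat) set)"
    by (rule bij_betwI[where g = "\<lambda>(n, k). (n + k, n)"]) auto
  define h where "h = (\<lambda>(p, n). f n (p - n))"
  have fin: "(\<Sum>\<^sub>\<infinity>n\<in>{..p}. g n) = (\<Sum>n\<le>p. g n)" for g :: "nat \<Rightarrow> real" and p
    by (rule infsum_finite) simp
  have "(\<lambda>x. norm (h x)) summable_on ?S"
    unfolding Infinite_Sum.abs_summable_on_Sigma_iff
  proof
    have "(\<lambda>p. \<Sum>n\<le>p. \<bar>f n (p - n)\<bar>) summable_on UNIV"
      using assms by (rule summable_nonneg_imp_summable_on) (simp add: sum_nonneg)
    then show "(\<lambda>x. norm (\<Sum>\<^sub>\<infinity>y\<in>{..x}. norm (h (x, y)))) summable_on UNIV"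
      by (simp add: h_def fin sum_nonneg)
  qed auto
  then have h: "h summable_on ?S" by (rule abs_summable_summable)
  have hg: "h = (\<lambda>x. (\<lambda>(n, k). f n k) (?g x))" by (auto simp: h_def)
  have "(\<lambda>(n, k). f n k) summable_on UNIV \<times> UNIV"
    using h summable_on_reindex_bij_betw[OF bij, of "\<lambda>(n, k). f n k"] unfolding hg by simp
  then have "(\<Sum>\<^sub>\<infinity>n. \<Sum>\<^sub>\<infinity>k. f n k) = infsum (\<lambda>(n, k). f n k) (UNIV \<times> UNIV)"
    by (rule infsum_Sigma'_banach)
  also have "\<dots> = infsum h ?S"
    unfolding hg by (rule infsum_reindex_bij_betw[OF bij, symmetric])
  also have "\<dots> = (\<Sum>\<^sub>\<infinity>p. \<Sum>\<^sub>\<infinity>n\<in>{..p}. h (p, n))"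
    using h by (rule infsum_Sigma_banach[symmetric])
  also have "\<dots> = (\<Sum>\<^sub>\<infinity>p. \<Sum>n\<le>p. f n (p - n))"
    by (simp add: h_def fin)
  also have "\<dots> = (\<Sum>p. \<Sum>n\<le>p. f n (p - n))"
  proof -
    have "summable (\<lambda>p. norm (\<Sum>n\<le>p. f n (p - n)))"
      by (rule summable_comparison_test[OF _ assms]) (auto intro!: exI[of _ 0])
    note norm_summable_imp_has_sum[OF this summable_sums[OF summable_norm_cancel[OF this]]]
    then show ?thesis by (rule infsumI)
  qed
  finally show ?thesis .
qed

subsection \<open>Moments of the measures \<open>\<Pi>\<^sub>\<alpha>\<close>\<close>

lemma sets_Pi_measure [measurable_cong]: "sets (Pi_measure a) = sets (restrict_space borel {-1..1})"
  by (simp add: Pi_measure_def sets_restrict_space)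

lemma space_Pi_measure: "space (Pi_measure a) = {-1..1}"
  using sets_eq_imp_space_eq[OF sets_Pi_measure[of a]] by (simp add: space_restrict_space)

lemma borel_measurable_Pi_measure:
  "f \<in> borel_measurable borel \<Longrightarrow> f \<in> borel_measurable (Pi_measure a)"
  by (subst measurable_cong_sets[OF sets_Pi_measure refl]) (rule measurable_restrict_space1)

text \<open>The substitution x = u^2 leads to the Beta integral; it is injective only on half of the
  interval.\<close>

lemma Pi_weight_even_moment_half:
  fixes a :: real and j :: nat
  assumes "-1/2 < a"
  defines "w \<equiv> \<lambda>u::real. u ^ (2 * j) * (1 - u\<^sup>2) powr (a - 1/2)"
  shows "set_integrable lborel {0<..<1} w"
    and "2 * (LINT u:{0<..<1}|lborel. w u) = Beta (real j + 1/2) (a + 1/2)"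
proof -
  define F where "F x = x powr (real j + 1/2 - 1) * (1 - x) powr (a + 1/2 - 1)" for x :: real
  have F: "(F has_integral Beta (real j + 1/2) (a + 1/2)) {0<..<1}"
    using has_integral_Beta_real[of "real j + 1/2" "a + 1/2"] assms
    by (simp add: has_integral_Icc_iff_Ioo F_def[abs_def])
  then have "F absolutely_integrable_on {0<..<1}"
    by (intro nonnegative_absolutely_integrable_1) (auto simp: has_integral_iff F_def)
  moreover have dsq: "((\<lambda>u. u\<^sup>2) has_field_derivative 2 * u) (at u within {0<..<1})" for u :: real
    by (auto intro!: derivative_eq_intros)
  moreover have inj: "inj_on (\<lambda>u::real. u\<^sup>2) {0<..<1}"
    by (auto simp: inj_on_def power2_eq_iff)
  moreover have img: "(\<lambda>u::real. u\<^sup>2) ` {0<..<1} = {0<..<1}"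
  proof
    show "(\<lambda>u::real. u\<^sup>2) ` {0<..<1} \<subseteq> {0<..<1}" by (auto simp: power_less_one_iff)
    show "{0<..<1} \<subseteq> (\<lambda>u::real. u\<^sup>2) ` {0<..<1}"
    proof
      fix x :: real assume "x \<in> {0<..<1}"
      then show "x \<in> (\<lambda>u. u\<^sup>2) ` {0<..<1}" by (intro image_eqI[of _ _ "sqrt x"]) auto
    qed
  qed
  ultimately have "(\<lambda>u. \<bar>2 * u\<bar> * F (u\<^sup>2)) absolutely_integrable_on {0<..<1} \<and>
     integral {0<..<1} (\<lambda>u. \<bar>2 * u\<bar> * F (u\<^sup>2)) = Beta (real j + 1/2) (a + 1/2)"
    using F by (subst has_absolute_integral_change_of_variables_1'[OF _ dsq inj])
      (simp_all add: img has_integral_iff)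
  moreover have eq: "\<bar>2 * u\<bar> * F (u\<^sup>2) = 2 * w u" if "u \<in> {0<..<1}" for u
  proof -
    have u: "u > 0" using that by simp
    have "(u\<^sup>2) powr (real j + 1/2 - 1) = u powr (2 * real j - 1)"
      using u by (simp add: powr_powr right_diff_distrib flip: powr_numeral)
    also have "u * u powr (2 * real j - 1) = u ^ (2 * j)"
      using u by (simp add: powr_mult_base flip: powr_realpow)
    finally show ?thesis using u by (simp add: F_def w_def)
  qed
  moreover have "(\<lambda>u. \<bar>2 * u\<bar> * F (u\<^sup>2)) absolutely_integrable_on {0<..<1}
      \<longleftrightarrow> (\<lambda>u. 2 * w u) absolutely_integrable_on {0<..<1}"
    by (rule set_integrable_cong; (rule refl | erule eq))
  moreover have "integral {0<..<1} (\<lambda>u. \<bar>2 * u\<bar> * F (u\<^sup>2)) = integral {0<..<1} (\<lambda>u. 2 * w u)"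
    by (rule Henstock_Kurzweil_Integration.integral_cong) (erule eq)
  ultimately have ai: "(\<lambda>u. 2 * w u) absolutely_integrable_on {0<..<1}"
    and I: "integral {0<..<1} (\<lambda>u. 2 * w u) = Beta (real j + 1/2) (a + 1/2)"
    by simp_all
  have [measurable]: "w \<in> borel_measurable borel" unfolding w_def by measurable
  have "(\<lambda>u. 1/2 * (2 * w u)) absolutely_integrable_on {0<..<1}"
    using ai by (rule set_integrable_mult_right)
  then have aw: "w absolutely_integrable_on {0<..<1}" by simp
  then show int: "set_integrable lborel {0<..<1} w"
    unfolding set_integrable_def by (subst (asm) integrable_completion) auto
  have "(LINT u:{0<..<1}|lborel. w u) = (LINT u:{0<..<1}|lebesgue. w u)"
    unfolding set_lebesgue_integral_def by (subst integral_completion) auto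
  also have "\<dots> = integral {0<..<1} w"
    using set_lebesgue_integral_eq_integral(2)[OF aw] .
  finally show "2 * (LINT u:{0<..<1}|lborel. w u) = Beta (real j + 1/2) (a + 1/2)"
    using I by simp
qed

lemma Pi_weight_moments:
  fixes a :: real and j :: nat
  assumes "-1/2 < a"
  defines "w \<equiv> \<lambda>n (u::real). u ^ n * (1 - u\<^sup>2) powr (a - 1/2)"
  shows "set_integrable lborel {-1..1} (w (2 * j))"
    and "(LINT u:{-1..1}|lborel. w (2 * j) u) = Beta (real j + 1/2) (a + 1/2)"
    and "(LINT u:{-1..1}|lborel. w (Suc (2 * j)) u) = 0"
proof -
  define h where "h n u = indicator {0<..<1} u * w n u" for n and u :: real
  have even: "w (2 * j) (- u) = w (2 * j) u" and odd: "w (Suc (2 * j)) (- u) = - w (Suc (2 * j)) u" for u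
    by (simp_all add: w_def)
  have hi: "integrable lborel (h (2 * j))" and hI: "2 * (\<integral>u. h (2 * j) u \<partial>lborel) = Beta (real j + 1/2) (a + 1/2)"
    using Pi_weight_even_moment_half[OF assms(1), of j]
    by (simp_all add: h_def[abs_def] w_def set_integrable_def set_lebesgue_integral_def)
  have hi': "integrable lborel (\<lambda>u. h (2 * j) (- u))"
    using lborel_integrable_real_affine[OF hi, of "-1" 0] by simp
  have hI': "(\<integral>u. h (2 * j) (- u) \<partial>lborel) = (\<integral>u. h (2 * j) u \<partial>lborel)"
    using lborel_integral_real_affine[of "-1" "h (2 * j)" 0] by simp
  have [measurable]: "w n \<in> borel_measurable borel" for n unfolding w_def by measurable
  have [measurable]: "h n \<in> borel_measurable borel" for n unfolding h_def by measurable
  \<comment> \<open>The reflected halves of [-1, 1] miss the points 0, 1 and -1, hence an identity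
    almost everywhere.\<close>
  have "AE u in lborel. u \<noteq> (0::real)" "AE u in lborel. u \<noteq> (1::real)" "AE u in lborel. u \<noteq> (-1::real)"
    by (rule AE_lborel_singleton)+
  then have ae: "AE u in lborel. indicator {-1..1} u *\<^sub>R w (2 * j) u = h (2 * j) u + h (2 * j) (- u)"
    by eventually_elim (auto simp: h_def indicator_def even)
  show "set_integrable lborel {-1..1} (w (2 * j))"
    unfolding set_integrable_def
    by (subst integrable_cong_AE[OF _ _ ae]) (use hi hi' in auto)
  have "(LINT u:{-1..1}|lborel. w (2 * j) u) = (\<integral>u. h (2 * j) u + h (2 * j) (- u) \<partial>lborel)"
    unfolding set_lebesgue_integral_def by (rule integral_cong_AE[OF _ _ ae]) auto
  also have "\<dots> = Beta (real j + 1/2) (a + 1/2)"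
    using hi hi' hI hI' by simp
  finally show "(LINT u:{-1..1}|lborel. w (2 * j) u) = Beta (real j + 1/2) (a + 1/2)" .
  have "(\<integral>u. indicator {-1..1} u *\<^sub>R w (Suc (2 * j)) u \<partial>lborel)
      = (\<integral>u. indicator {-1..1} (-u) *\<^sub>R w (Suc (2 * j)) (- u) \<partial>lborel)"
    using lborel_integral_real_affine[of "-1" "\<lambda>u. indicator {-1..1} u *\<^sub>R w (Suc (2 * j)) u" 0] by simp
  also have "\<dots> = (\<integral>u. - (indicator {-1..1} u *\<^sub>R w (Suc (2 * j)) u) \<partial>lborel)"
    by (intro Bochner_Integration.integral_cong refl) (auto simp: odd indicator_def)
  also have "\<dots> = - (\<integral>u. indicator {-1..1} u *\<^sub>R w (Suc (2 * j)) u \<partial>lborel)"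
    by simp
  finally show "(LINT u:{-1..1}|lborel. w (Suc (2 * j)) u) = 0"
    unfolding set_lebesgue_integral_def by linarith
qed

lemma integral_Pi_measure:
  assumes "-1/2 < a" and f: "f \<in> borel_measurable borel"
  shows "(\<integral>u. f u \<partial>Pi_measure a)
    = Gamma (a + 1) / (sqrt pi * Gamma (a + 1/2)) * (LINT u:{-1..1}|lborel. f u * (1 - u\<^sup>2) powr (a - 1/2))"
proof -
  define K where "K = Gamma (a + 1) / (sqrt pi * Gamma (a + 1/2))"
  have K: "K \<ge> 0" using assms(1) by (auto simp: K_def intro!: divide_nonneg_nonneg mult_nonneg_nonneg less_imp_le[OF Gamma_real_pos])
  have "Pi_measure a = density (restrict_space lborel {-1..1}) (\<lambda>u. ennreal (K * (1 - u\<^sup>2) powr (a - 1/2)))"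
    using assms(1) by (simp add: Pi_measure_def K_def)
  then have "(\<integral>u. f u \<partial>Pi_measure a) = (\<integral>u. K * (1 - u\<^sup>2) powr (a - 1/2) * f u \<partial>restrict_space lborel {-1..1})"
    using K f by (simp add: integral_real_density measurable_restrict_space1)
  also have "\<dots> = (\<integral>u. indicator {-1..1} u *\<^sub>R (K * (1 - u\<^sup>2) powr (a - 1/2) * f u) \<partial>lborel)"
    by (rule integral_restrict_space) simp
  also have "\<dots> = (\<integral>u. K * (indicator {-1..1} u *\<^sub>R (f u * (1 - u\<^sup>2) powr (a - 1/2))) \<partial>lborel)"
    by (intro Bochner_Integration.integral_cong refl) (simp add: mult_ac)
  also have "\<dots> = K * (\<integral>u. indicator {-1..1} u *\<^sub>R (f u * (1 - u\<^sup>2) powr (a - 1/2)) \<partial>lborel)"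
    by (rule integral_mult_right_zero)
  finally show ?thesis by (simp add: K_def set_lebesgue_integral_def)
qed

text \<open>In the definition the mass 1/2 is a quotient in \<open>ennreal\<close>; as the image of
  a real number it suits the lemmas on point measures.\<close>

lemma Pi_measure_minus_half:
  "Pi_measure (-1/2) = distr (point_measure {-1, 1} (\<lambda>_. ennreal (1/2))) (restrict_space borel {-1..1}) (\<lambda>u. u)"
proof -
  have "(1/2 :: ennreal) = ennreal (1/2)"
    by (metis divide_ennreal ennreal_1 ennreal_numeral zero_le_one zero_less_numeral)
  then show ?thesis by (simp only: Pi_measure_def refl if_True)
qed

lemma finite_measure_Pi_measure:
  assumes "-1/2 \<le> a"
  shows "finite_measure (Pi_measure a)"
proof (cases "a = -1/2")
  case True
  have "(\<lambda>u. u) \<in> measurable (point_measure {-1, 1} (\<lambda>_. ennreal (1/2))) (restrict_space borel {-1..1::real})"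
    by (simp add: measurable_point_measure_eq1 space_restrict_space)
  then have "finite_measure (distr (point_measure {-1, 1} (\<lambda>_. ennreal (1/2))) (restrict_space borel {-1..1}) (\<lambda>u::real. u))"
    by (intro finite_measure.finite_measure_distr finite_measureI) (simp_all add: emeasure_point_measure_finite space_point_measure ennreal_mult_eq_top_iff)
  then show ?thesis unfolding True Pi_measure_minus_half .
next
  case False
  then have a: "-1/2 < a" using assms by simp
  define K where "K = Gamma (a + 1) / (sqrt pi * Gamma (a + 1/2))"
  have K: "K \<ge> 0" using a by (auto simp: K_def intro!: divide_nonneg_nonneg mult_nonneg_nonneg less_imp_le[OF Gamma_real_pos])
  have "integrable lborel (\<lambda>u. K * (indicator {-1..1} u * (1 - u\<^sup>2) powr (a - 1/2)))"
    using Pi_weight_moments(1)[OF a, of 0] unfolding set_integrable_def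
    by (intro integrable_mult_right) simp
  then have "(\<integral>\<^sup>+u. ennreal (norm (K * (indicator {-1..1} u * (1 - u\<^sup>2) powr (a - 1/2)))) \<partial>lborel) < \<infinity>"
    unfolding integrable_iff_bounded by (rule conjunct2)
  moreover have "emeasure (Pi_measure a) {-1..1}
    = (\<integral>\<^sup>+u. ennreal (K * (1 - u\<^sup>2) powr (a - 1/2)) * indicator {-1..1} u \<partial>restrict_space lborel {-1..1})"
  proof -
    have "Pi_measure a = density (restrict_space lborel {-1..1}) (\<lambda>u. ennreal (K * (1 - u\<^sup>2) powr (a - 1/2)))"
      using False by (simp add: Pi_measure_def K_def)
    then show ?thesis
      by (simp only:) (rule emeasure_density; simp add: sets_restrict_space_iff measurable_restrict_space1)
  qed
  moreover have "\<dots> = (\<integral>\<^sup>+u. ennreal (norm (K * (indicator {-1..1} u * (1 - u\<^sup>2) powr (a - 1/2)))) \<partial>lborel)"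
    using K by (subst nn_integral_restrict_space) (auto intro!: nn_integral_cong simp: indicator_def)
  ultimately show ?thesis by (intro finite_measureI) (simp add: space_Pi_measure)
qed

text \<open>For a > -1/2 the normalising constant and the Beta value combine to the quotient. At a =
  -1/2 both rising factorials coincide, and the quotient 1 is the even moment of the two point
  masses, so one formula covers the limiting case.\<close>

lemma Pi_measure_moments:
  assumes "-1/2 \<le> a"
  shows "(\<integral>u. u ^ (2 * j) \<partial>Pi_measure a) = pochhammer (1/2) j / pochhammer (a + 1) j"
    and "(\<integral>u. u ^ Suc (2 * j) \<partial>Pi_measure a) = 0"
proof -
  have "(\<integral>u. u ^ (2 * j) \<partial>Pi_measure a) = pochhammer (1/2) j / pochhammer (a + 1) j
    \<and> (\<integral>u. u ^ Suc (2 * j) \<partial>Pi_measure a) = 0"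
  proof (cases "a = -1/2")
    case True
    have m: "(\<lambda>u. u) \<in> measurable (point_measure {-1, 1} (\<lambda>_. ennreal (1/2))) (restrict_space borel {-1..1::real})"
      by (simp add: measurable_point_measure_eq1 space_restrict_space)
    have M: "(\<integral>u. u ^ n \<partial>Pi_measure a) = (1 + (-1) ^ n) / 2" for n
    proof -
      have "(\<integral>u. u ^ n \<partial>Pi_measure a) = (\<integral>u. u ^ n \<partial>point_measure {-1, 1} (\<lambda>_. ennreal (1/2)))"
        unfolding True Pi_measure_minus_half using m by (simp add: integral_distr measurable_restrict_space1)
      also have "\<dots> = (1 + (-1) ^ n) / 2"
        by (subst lebesgue_integral_point_measure_finite) auto
      finally show ?thesis .
    qed
    moreover have "pochhammer (1/2 :: real) j \<noteq> 0" using pochhammer_pos[of "1/2 :: real" j] by linarith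
    ultimately show ?thesis by (simp add: M del: power_Suc) (simp add: True)
  next
    case False
    then have a: "-1/2 < a" using assms by simp
    have na: "1/2 \<notin> (\<int>\<^sub>\<le>\<^sub>0 :: real set)" "a + 1 \<notin> \<int>\<^sub>\<le>\<^sub>0" using a by (auto elim!: nonpos_Ints_cases)
    have G: "Gamma (a + 1) > 0" "Gamma (a + 1/2) > 0" "Gamma (a + 1 + real j) > 0"
      using a by (auto intro!: Gamma_real_pos)
    have "Gamma (a + 1) / (sqrt pi * Gamma (a + 1/2)) * Beta (real j + 1/2) (a + 1/2)
       = pochhammer (1/2) j / pochhammer (a + 1) j"
    proof -
      have eq: "real j + 1/2 + (a + 1/2) = a + 1 + real j" by simp
      have B: "Beta (real j + 1/2) (a + 1/2) = Gamma (real j + 1/2) * Gamma (a + 1/2) / Gamma (a + 1 + real j)"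
        by (simp only: Beta_def eq)
      show ?thesis unfolding B pochhammer_Gamma[OF na(1)] pochhammer_Gamma[OF na(2)]
          Gamma_one_half_real add.commute[of "1/2" "real j"]
        using G by simp
    qed
    then show ?thesis using Pi_weight_moments(2,3)[OF a, of j]
      by (simp add: integral_Pi_measure[OF a] del: power_Suc)
  qed
  then show "(\<integral>u. u ^ (2 * j) \<partial>Pi_measure a) = pochhammer (1/2) j / pochhammer (a + 1) j"
    and "(\<integral>u. u ^ Suc (2 * j) \<partial>Pi_measure a) = 0" by auto
qed

lemma sum_even_indices:
  fixes g :: "nat \<Rightarrow> real"
  assumes "\<And>i. odd i \<Longrightarrow> g i = 0"
  shows "(\<Sum>i\<le>2 * p. g i) = (\<Sum>j\<le>p. g (2 * j))"
  by (induction p) (simp_all add: assms)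

lemma finite_measure_Pi_pair:
  assumes "-1/2 \<le> a" "-1/2 \<le> b"
  shows "finite_measure (Pi_measure a \<Otimes>\<^sub>M Pi_measure b)"
  using assms by (intro finite_measure_pair_measure finite_measure_Pi_measure)

lemma borel_measurable_Pi_pair:
  assumes "(\<lambda>(u, v). f u v) \<in> borel_measurable (borel \<Otimes>\<^sub>M borel)"
  shows "(\<lambda>(u, v). f u v) \<in> borel_measurable (Pi_measure a \<Otimes>\<^sub>M Pi_measure b)"
proof -
  have "(\<lambda>x. (fst x, snd x)) \<in> measurable (Pi_measure a \<Otimes>\<^sub>M Pi_measure b) (borel \<Otimes>\<^sub>M borel)"
    by (intro measurable_Pair measurable_compose[OF measurable_fst borel_measurable_Pi_measure]
        measurable_compose[OF measurable_snd borel_measurable_Pi_measure]) auto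
  from measurable_compose[OF this assms] show ?thesis by (simp add: case_prod_unfold)
qed

lemma integral_Pi_pair_monomial:
  assumes a: "-1/2 \<le> a" and b: "-1/2 \<le> b"
  shows "integrable (Pi_measure a \<Otimes>\<^sub>M Pi_measure b) (\<lambda>(u, v). u ^ i * v ^ k)"
    and "(\<integral>(u, v). u ^ i * v ^ k \<partial>(Pi_measure a \<Otimes>\<^sub>M Pi_measure b))
      = (\<integral>u. u ^ i \<partial>Pi_measure a) * (\<integral>v. v ^ k \<partial>Pi_measure b)"
proof -
  interpret A: finite_measure "Pi_measure a" by (rule finite_measure_Pi_measure[OF a])
  interpret B: finite_measure "Pi_measure b" by (rule finite_measure_Pi_measure[OF b])
  interpret AB: pair_sigma_finite "Pi_measure a" "Pi_measure b" ..
  interpret P: finite_measure "Pi_measure a \<Otimes>\<^sub>M Pi_measure b" by (rule finite_measure_Pi_pair[OF a b])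
  show int: "integrable (Pi_measure a \<Otimes>\<^sub>M Pi_measure b) (\<lambda>(u, v). u ^ i * v ^ k)"
  proof (rule P.integrable_const_bound[of _ 1])
    show "AE x in Pi_measure a \<Otimes>\<^sub>M Pi_measure b. norm (case x of (u, v) \<Rightarrow> u ^ i * v ^ k) \<le> 1"
      by (rule AE_I2) (auto simp: space_pair_measure space_Pi_measure abs_mult power_abs
          intro!: mult_le_one power_le_one)
    show "(\<lambda>(u, v). u ^ i * v ^ k) \<in> borel_measurable (Pi_measure a \<Otimes>\<^sub>M Pi_measure b)"
      by (rule borel_measurable_Pi_pair) measurable
  qed
  show "(\<integral>(u, v). u ^ i * v ^ k \<partial>(Pi_measure a \<Otimes>\<^sub>M Pi_measure b))
      = (\<integral>u. u ^ i \<partial>Pi_measure a) * (\<integral>v. v ^ k \<partial>Pi_measure b)"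
    using AB.integral_fst'[OF int] by simp
qed

lemma integral_Pi_pair_power:
  assumes a: "-1/2 \<le> a" and b: "-1/2 \<le> b"
  shows "(\<integral>(u, v). (u * s + v * c) ^ m \<partial>(Pi_measure a \<Otimes>\<^sub>M Pi_measure b))
    = (\<Sum>i\<le>m. real (m choose i) * s ^ i * c ^ (m - i) *
        ((\<integral>u. u ^ i \<partial>Pi_measure a) * (\<integral>v. v ^ (m - i) \<partial>Pi_measure b)))"
proof -
  have "(\<integral>(u, v). (u * s + v * c) ^ m \<partial>(Pi_measure a \<Otimes>\<^sub>M Pi_measure b))
     = (\<integral>x. (\<Sum>i\<le>m. real (m choose i) * s ^ i * c ^ (m - i) * (case x of (u, v) \<Rightarrow> u ^ i * v ^ (m - i)))
          \<partial>(Pi_measure a \<Otimes>\<^sub>M Pi_measure b))"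
    by (intro Bochner_Integration.integral_cong refl)
       (auto simp: binomial_ring power_mult_distrib mult_ac intro!: sum.cong)
  also have "\<dots> = (\<Sum>i\<le>m. real (m choose i) * s ^ i * c ^ (m - i) *
        (\<integral>(u, v). u ^ i * v ^ (m - i) \<partial>(Pi_measure a \<Otimes>\<^sub>M Pi_measure b)))"
    by (subst Bochner_Integration.integral_sum)
       (auto intro!: integrable_mult_right integral_Pi_pair_monomial a b)
  finally show ?thesis unfolding integral_Pi_pair_monomial(2)[OF a b] .
qed

section \<open>Series expansion of the double integral\<close>

context jacobi_parameters
begin

context
  assumes \<alpha>_ge: "-1/2 \<le> \<alpha>" and \<beta>_ge: "-1/2 \<le> \<beta>"
begin

text \<open>Of two exponents with odd sum one is odd, and odd moments vanish.\<close>

lemma integral_Pi_pair_odd_power: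
  "(\<integral>(u, v). (u * s + v * c) ^ Suc (2 * p) \<partial>(Pi_measure \<alpha> \<Otimes>\<^sub>M Pi_measure \<beta>)) = 0"
  unfolding integral_Pi_pair_power[OF \<alpha>_ge \<beta>_ge]
proof (intro sum.neutral ballI)
  fix i assume i: "i \<in> {..Suc (2 * p)}"
  have "(\<integral>u. u ^ i \<partial>Pi_measure \<alpha>) * (\<integral>v. v ^ (Suc (2 * p) - i) \<partial>Pi_measure \<beta>) = 0"
  proof (cases "even i")
    case True
    with i have "odd (Suc (2 * p) - i)" by auto
    then obtain k where "Suc (2 * p) - i = 2 * k + 1" by (rule oddE)
    then have k: "Suc (2 * p) - i = Suc (2 * k)" by simp
    show ?thesis unfolding k Pi_measure_moments(2)[OF \<beta>_ge] by simp
  next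
    case False
    then obtain k where k: "i = Suc (2 * k)" by (auto elim: oddE)
    show ?thesis unfolding k Pi_measure_moments(2)[OF \<alpha>_ge] by simp
  qed
  then show "real (Suc (2 * p) choose i) * s ^ i * c ^ (Suc (2 * p) - i) *
     ((\<integral>u. u ^ i \<partial>Pi_measure \<alpha>) * (\<integral>v. v ^ (Suc (2 * p) - i) \<partial>Pi_measure \<beta>)) = 0"
    by (simp del: power_Suc)
qed

text \<open>Because (1/2)_j = (2j)! / (4^j j!), the binomial coefficient of 2p over 2j times the two
  moments is (2p)! / 4^p times \<open>weight_coeff\<close>.\<close>

lemma integral_Pi_pair_even_power:
  "(\<integral>(u, v). (u * s + v * c) ^ (2 * p) \<partial>(Pi_measure \<alpha> \<Otimes>\<^sub>M Pi_measure \<beta>))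
     = fact (2 * p) / 4 ^ p * appell_form p (s\<^sup>2) (c\<^sup>2)"
proof -
  have odd0: "(\<integral>u. u ^ i \<partial>Pi_measure \<alpha>) = 0" if "odd i" for i
    using that Pi_measure_moments(2)[OF \<alpha>_ge] by (auto elim!: oddE simp del: power_Suc)
  have half: "pochhammer (1/2 :: real) j = fact (2 * j) / (4 ^ j * fact j)" for j :: nat
    by (simp add: fact_double power_mult)
  have "(\<integral>(u, v). (u * s + v * c) ^ (2 * p) \<partial>(Pi_measure \<alpha> \<Otimes>\<^sub>M Pi_measure \<beta>))
    = (\<Sum>j\<le>p. real ((2 * p) choose (2 * j)) * s ^ (2 * j) * c ^ (2 * p - 2 * j) *
        ((\<integral>u. u ^ (2 * j) \<partial>Pi_measure \<alpha>) * (\<integral>v. v ^ (2 * p - 2 * j) \<partial>Pi_measure \<beta>)))"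
    unfolding integral_Pi_pair_power[OF \<alpha>_ge \<beta>_ge]
    by (rule sum_even_indices) (simp add: odd0)
  also have "\<dots> = (\<Sum>j\<le>p. fact (2 * p) / 4 ^ p * (weight_coeff j (p - j) * (s\<^sup>2) ^ j * (c\<^sup>2) ^ (p - j)))"
  proof (intro sum.cong refl)
    fix j assume "j \<in> {..p}"
    then obtain k where p: "p = j + k" using le_Suc_ex by auto
    have d: "2 * p - 2 * j = 2 * k" "p - j = k" by (simp_all add: p)
    have bin: "real ((2 * p) choose (2 * j)) = fact (2 * p) / (fact (2 * j) * fact (2 * k))"
      using binomial_fact[of "2 * j" "2 * p"] d by (simp add: p)
    have sq: "s ^ (2 * j) = (s\<^sup>2) ^ j" "c ^ (2 * k) = (c\<^sup>2) ^ k" by (simp_all add: power_mult)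
    show "real ((2 * p) choose (2 * j)) * s ^ (2 * j) * c ^ (2 * p - 2 * j) *
        ((\<integral>u. u ^ (2 * j) \<partial>Pi_measure \<alpha>) * (\<integral>v. v ^ (2 * p - 2 * j) \<partial>Pi_measure \<beta>))
      = fact (2 * p) / 4 ^ p * (weight_coeff j (p - j) * (s\<^sup>2) ^ j * (c\<^sup>2) ^ (p - j))"
      unfolding d bin Pi_measure_moments(1)[OF \<alpha>_ge] Pi_measure_moments(1)[OF \<beta>_ge] half sq weight_coeff_def
      by (simp add: p power_add mult_ac)
  qed
  finally show ?thesis by (simp add: appell_form_def sum_distrib_left)
qed

text \<open>The binomial series in z = u s + v c, integrated termwise. On the support |z| \<le> s +
  c \<le> 1 < C, so the series at z = 1 is a summable majorant; only even degrees survive.\<close>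

lemma sums_integral_Pi_pair:
  fixes s c C :: real
  assumes s: "0 \<le> s" and c: "0 \<le> c" and sc: "s + c \<le> 1" and C: "1 < C"
  shows "(\<lambda>p. pochhammer (\<alpha> + \<beta> + 2) (2 * p) / 4 ^ p * appell_form p (s\<^sup>2) (c\<^sup>2)
            * C powr (- (\<alpha> + \<beta> + 2) - 2 * real p))
    sums (\<integral>(u, v). 1 / (C - (u * s + v * c)) powr (\<alpha> + \<beta> + 2) \<partial>(Pi_measure \<alpha> \<Otimes>\<^sub>M Pi_measure \<beta>))"
proof -
  let ?M = "Pi_measure \<alpha> \<Otimes>\<^sub>M Pi_measure \<beta>"
  interpret P: finite_measure ?M by (rule finite_measure_Pi_pair[OF \<alpha>_ge \<beta>_ge])
  define \<sigma> where "\<sigma> = \<alpha> + \<beta> + 2"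
  have \<sigma>: "\<sigma> > 0" using \<alpha>_gt \<beta>_gt by (simp add: \<sigma>_def)
  define b where "b m = pochhammer \<sigma> m / fact m * C powr (- \<sigma> - real m)" for m
  define z where "z x = (case x of (u, v) \<Rightarrow> u * s + v * c)" for x :: "real \<times> real"
  have b: "b m \<ge> 0" for m unfolding b_def using \<sigma>
    by (intro mult_nonneg_nonneg divide_nonneg_nonneg pochhammer_nonneg) auto
  have bs: "summable b"
    using sums_negative_binomial[of 1 C \<sigma>] C by (simp add: b_def[abs_def] sums_iff)
  have z: "\<bar>z x\<bar> \<le> 1" if xM: "x \<in> space ?M" for x
  proof -
    obtain u v where x: "x = (u, v)" "\<bar>u\<bar> \<le> 1" "\<bar>v\<bar> \<le> 1"
      using xM by (cases x) (auto simp: space_pair_measure space_Pi_measure abs_le_iff)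
    have "\<bar>u * s + v * c\<bar> \<le> \<bar>u\<bar> * s + \<bar>v\<bar> * c"
      using s c by (intro order.trans[OF abs_triangle_ineq]) (simp add: abs_mult)
    also have "\<dots> \<le> 1 * s + 1 * c" using x s c by (intro add_mono mult_right_mono) auto
    finally show ?thesis using sc by (simp add: x z_def)
  qed
  define f where "f m x = b m * z x ^ m" for m x
  have zm[measurable]: "z \<in> borel_measurable ?M"
    unfolding z_def by (rule borel_measurable_Pi_pair) measurable
  have fb: "norm (f m x) \<le> b m" if "x \<in> space ?M" for m x
  proof -
    have "\<bar>z x\<bar> ^ m \<le> 1" using z[OF that] by (simp add: power_le_one)
    then show ?thesis using b[of m] by (simp add: f_def abs_mult power_abs mult_left_le)
  qed
  have fi: "integrable ?M (f m)" for m
  proof (rule P.integrable_const_bound)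
    show "AE x in ?M. norm (f m x) \<le> b m" by (rule AE_I2, rule fb)
    show "f m \<in> borel_measurable ?M" unfolding f_def[abs_def] by measurable
  qed
  have "(\<lambda>m. \<integral>x. f m x \<partial>?M) sums (\<integral>x. (\<Sum>m. f m x) \<partial>?M)"
  proof (rule sums_integral[OF fi])
    show "AE x in ?M. summable (\<lambda>i. norm (f i x))"
    proof (rule AE_I2)
      fix x assume "x \<in> space ?M"
      then have "norm (norm (f i x)) \<le> b i" for i using fb[of x i] by simp
      then show "summable (\<lambda>i. norm (f i x))"
        by (rule summable_comparison_test'[OF bs])
    qed
    have "norm (\<integral>x. norm (f m x) \<partial>?M) \<le> b m * measure ?M (space ?M)" for m
    proof -
      have "(\<integral>x. norm (f m x) \<partial>?M) \<le> (\<integral>x. b m \<partial>?M)"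
        by (intro integral_mono integrable_norm fi P.integrable_const fb)
      then show ?thesis by (simp add: mult.commute)
    qed
    then show "summable (\<lambda>i. \<integral>x. norm (f i x) \<partial>?M)"
      by (rule summable_comparison_test'[OF summable_mult2[OF bs]])
  qed
  also have "(\<integral>x. (\<Sum>m. f m x) \<partial>?M) = (\<integral>(u, v). 1 / (C - (u * s + v * c)) powr \<sigma> \<partial>?M)"
  proof (intro Bochner_Integration.integral_cong refl)
    fix x assume x: "x \<in> space ?M"
    have "(\<lambda>m. f m x) sums (1 / (C - z x) powr \<sigma>)"
      using sums_negative_binomial[of "z x" C \<sigma>] z[OF x] C by (simp add: f_def b_def mult_ac)
    then show "(\<Sum>m. f m x) = (case x of (u, v) \<Rightarrow> 1 / (C - (u * s + v * c)) powr \<sigma>)"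
      by (simp add: sums_iff z_def case_prod_unfold)
  qed
  finally have S: "(\<lambda>m. \<integral>x. f m x \<partial>?M) sums (\<integral>(u, v). 1 / (C - (u * s + v * c)) powr \<sigma> \<partial>?M)" .
  have Im: "(\<integral>x. f m x \<partial>?M) = b m * (\<integral>(u, v). (u * s + v * c) ^ m \<partial>?M)" for m
    by (simp add: f_def z_def case_prod_unfold)
  have "(\<lambda>p. \<integral>x. f (2 * p) x \<partial>?M) sums (\<integral>(u, v). 1 / (C - (u * s + v * c)) powr \<sigma> \<partial>?M)"
  proof (subst sums_mono_reindex[of "\<lambda>p. 2 * p" "\<lambda>m. \<integral>x. f m x \<partial>?M"])
    fix m assume "m \<notin> range (\<lambda>p::nat. 2 * p)"
    then have "odd m" by (auto elim!: evenE)
    then obtain p where m: "m = Suc (2 * p)" by (auto elim: oddE)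
    show "(\<integral>x. f m x \<partial>?M) = 0"
      unfolding Im m integral_Pi_pair_odd_power by simp
  qed (auto simp: strict_mono_def intro: S)
  also have "(\<lambda>p. \<integral>x. f (2 * p) x \<partial>?M) = (\<lambda>p. pochhammer \<sigma> (2 * p) / 4 ^ p * appell_form p (s\<^sup>2) (c\<^sup>2)
            * C powr (- \<sigma> - 2 * real p))"
    unfolding Im integral_Pi_pair_even_power by (simp add: b_def mult_ac)
  finally show ?thesis by (simp add: \<sigma>_def)
qed

end

end

section \<open>Comparison of the kernel with the integral\<close>

theorem proposition4p1:
  fixes \<alpha> \<beta> t \<theta> \<phi> :: real
  assumes "\<alpha> \<ge> -1/2" and "\<beta> \<ge> -1/2"
    and "t > 0"
    and "\<theta> \<in> {0<..<pi}" and "\<phi> \<in> {0<..<pi}"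
  shows "jacobi_poisson_kernel \<alpha> \<beta> t \<theta> \<phi> =
    poisson_const \<alpha> \<beta> * sinh (t / 2) *
    (\<integral>(u, v). 1 / (cosh (t / 2) - 1 + jacobi_q \<theta> \<phi> u v) powr (\<alpha> + \<beta> + 2)
       \<partial>(Pi_measure \<alpha> \<Otimes>\<^sub>M Pi_measure \<beta>))"
proof -
  interpret jacobi_parameters \<alpha> \<beta> using assms by unfold_locales auto
  define \<sigma> where "\<sigma> = \<alpha> + \<beta> + 2"
  have \<sigma>: "\<sigma> \<ge> 1" using assms by (simp add: \<sigma>_def)
  define C where "C = cosh (t / 2)"
  have C: "C > 1" unfolding C_def using assms(3) cosh_real_strict_mono[of 0 "t / 2"] by simp
  \<comment> \<open>The 1 in \<open>jacobi_q\<close> cancels the -1 after cosh (t/2), so the base of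
    the power is C minus a linear form in u and v.\<close>
  define I where "I x y = (\<integral>(u, v). 1 / (C - (u * (sin (x / 2) * sin (y / 2)) + v * (cos (x / 2) * cos (y / 2)))) powr \<sigma>
       \<partial>(Pi_measure \<alpha> \<Otimes>\<^sub>M Pi_measure \<beta>))" for x y :: real
  define X where "X x = (sin (x / 2))\<^sup>2" for x :: real
  \<comment> \<open>The share of \<open>J n\<close> times \<open>J n\<close> in degree n + k of the
    expansion. The angles are arguments because the diagonal pairs are needed as well.\<close>
  define f where "f x y n k = pochhammer \<sigma> (2 * (n + k)) / 4 ^ (n + k) * C powr (- \<sigma> - 2 * real (n + k))
     * link_coeff n (n + k) * (J n (X x) * J n (X y))" for x y n k
  have S: "(\<lambda>p. \<Sum>n\<le>p. f x y n (p - n)) sums I x y"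
    if xy: "x \<in> {0<..<pi}" "y \<in> {0<..<pi}" for x y
  proof -
    have pos: "0 \<le> sin (w / 2)" "0 \<le> cos (w / 2)" if "w \<in> {0<..<pi}" for w
      using that by (auto intro!: sin_ge_zero cos_ge_zero)
    have "sin (x / 2) * sin (y / 2) + cos (x / 2) * cos (y / 2) = cos (x / 2 - y / 2)"
      by (simp add: cos_diff)
    then have le: "sin (x / 2) * sin (y / 2) + cos (x / 2) * cos (y / 2) \<le> 1" by simp
    have "(\<lambda>p. pochhammer \<sigma> (2 * p) / 4 ^ p * appell_form p ((sin (x / 2) * sin (y / 2))\<^sup>2) ((cos (x / 2) * cos (y / 2))\<^sup>2)
            * C powr (- \<sigma> - 2 * real p)) sums I x y"
      unfolding I_def \<sigma>_def by (rule sums_integral_Pi_pair) (use assms pos xy le C in auto)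
    also have "(sin (x / 2) * sin (y / 2))\<^sup>2 = X x * X y"
      by (simp add: X_def power_mult_distrib)
    also have "(cos (x / 2) * cos (y / 2))\<^sup>2 = (1 - X x) * (1 - X y)"
      by (simp add: X_def power_mult_distrib cos_squared_eq)
    also have "(\<lambda>p. pochhammer \<sigma> (2 * p) / 4 ^ p * appell_form p (X x * X y) ((1 - X x) * (1 - X y))
            * C powr (- \<sigma> - 2 * real p)) = (\<lambda>p. \<Sum>n\<le>p. f x y n (p - n))"
      unfolding appell_form_bilinear f_def sum_distrib_left sum_distrib_right
      by (intro ext sum.cong refl) (simp add: mult_ac)
    finally show ?thesis .
  qed
  have f_pos: "0 \<le> f x x n k" for x n k
    unfolding f_def using \<sigma> link_coeff_pos[of n "n + k"]
    by (intro mult_nonneg_nonneg[OF _ zero_le_square], intro mult_nonneg_nonneg divide_nonneg_nonneg pochhammer_nonneg)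
       auto
  text \<open>By the arithmetic-geometric mean inequality the two diagonals \<open>\<theta> = \<phi>\<close>, where all terms are
    nonnegative, control the absolute convergence of the double series.\<close>
  have f_abs: "\<bar>f \<theta> \<phi> n k\<bar> \<le> f \<theta> \<theta> n k + f \<phi> \<phi> n k" for n k
  proof -
    define w where "w = pochhammer \<sigma> (2 * (n + k)) / 4 ^ (n + k) * C powr (- \<sigma> - 2 * real (n + k)) * link_coeff n (n + k)"
    have w: "w \<ge> 0" unfolding w_def using \<sigma> link_coeff_pos[of n "n + k"]
      by (intro mult_nonneg_nonneg divide_nonneg_nonneg pochhammer_nonneg) auto
    have "\<bar>a * b\<bar> \<le> a * a + b * b" for a b :: real
    proof -
      have "2 * (\<bar>a\<bar> * \<bar>b\<bar>) \<le> a * a + b * b"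
        using sum_squares_bound[of "\<bar>a\<bar>" "\<bar>b\<bar>"] by (simp add: power2_eq_square mult.assoc)
      moreover have "0 \<le> \<bar>a\<bar> * \<bar>b\<bar>" by simp
      ultimately show ?thesis unfolding abs_mult by linarith
    qed
    then have "w * \<bar>J n (X \<theta>) * J n (X \<phi>)\<bar> \<le> w * (J n (X \<theta>) * J n (X \<theta>) + J n (X \<phi>) * J n (X \<phi>))"
      using w by (intro mult_left_mono)
    then show ?thesis unfolding f_def w_def[symmetric] using w by (simp add: abs_mult ring_distribs)
  qed
  have "summable (\<lambda>p. \<Sum>n\<le>p. \<bar>f \<theta> \<phi> n (p - n)\<bar>)"
  proof (rule summable_comparison_test')
    show "summable (\<lambda>p. (\<Sum>n\<le>p. f \<theta> \<theta> n (p - n)) + (\<Sum>n\<le>p. f \<phi> \<phi> n (p - n)))"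
      using S assms(4,5) by (intro summable_add) (auto simp: sums_iff)
    show "norm (\<Sum>n\<le>p. \<bar>f \<theta> \<phi> n (p - n)\<bar>) \<le> (\<Sum>n\<le>p. f \<theta> \<theta> n (p - n)) + (\<Sum>n\<le>p. f \<phi> \<phi> n (p - n))" for p
      unfolding sum.distrib[symmetric] by (simp add: sum_nonneg sum_mono f_abs)
  qed
  then have 1: "(\<Sum>\<^sub>\<infinity>n. \<Sum>\<^sub>\<infinity>k. f \<theta> \<phi> n k) = I \<theta> \<phi>"
    using infsum_antidiagonal S[OF assms(4,5)] by (simp add: sums_iff)
  define B where "B = Beta (\<alpha> + 1) (\<beta> + 1)"
  have B: "B > 0" unfolding B_def Beta_def using assms by (auto intro!: Gamma_real_pos divide_pos_pos mult_pos_pos)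
  have sinh_pos: "sinh (t / 2) > 0" using assms(3) by simp
  have 2: "exp (- t * \<bar>real n + (\<alpha> + \<beta> + 1) / 2\<bar>) * jacobi_trig n \<alpha> \<beta> \<theta> * jacobi_trig n \<alpha> \<beta> \<phi>
     = poisson_const \<alpha> \<beta> * sinh (t / 2) * (\<Sum>\<^sub>\<infinity>k. f \<theta> \<phi> n k)" for n
  proof -
    \<comment> \<open>That is, \<nu> = 2n + \<alpha> + \<beta> + 1, twice the frequency in the
      kernel; \<open>D\<close> collects the factors of \<open>f\<close> that do not depend on
      k.\<close>
    define \<nu> where "\<nu> = \<sigma> - 1 + 2 * real n"
    define g where "g k = pochhammer (\<nu> + 1 + real k) k / fact k * (2 * C) powr (- (\<nu> + 1 + 2 * real k))" for k
    define D where "D = 2 powr \<sigma> * pochhammer \<sigma> (2 * n) / appell_form n 1 1 * (J n (X \<theta>) * J n (X \<phi>))"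
    have "g sums (exp (- t * \<nu> / 2) / (2 * sinh (t / 2)))"
      unfolding g_def C_def using \<sigma> assms(3) by (intro sums_pochhammer_cosh) (auto simp: \<nu>_def)
    moreover have "g k \<ge> 0" for k
      unfolding g_def using \<sigma> by (intro mult_nonneg_nonneg divide_nonneg_nonneg pochhammer_nonneg) (auto simp: \<nu>_def)
    ultimately have g: "(\<Sum>\<^sub>\<infinity>k. g k) = exp (- t * \<nu> / 2) / (2 * sinh (t / 2))"
      by (intro infsumI sums_nonneg_imp_has_sum)
    have "f \<theta> \<phi> n k = D * g k" for k
    proof -
      \<comment> \<open>The middle factor cancels against the denominator of
        \<open>link_coeff\<close>; the last one is the central coefficient of the summation
        formula.\<close>
      have p1: "pochhammer \<sigma> (2 * (n + k)) = pochhammer \<sigma> (2 * n) * (pochhammer (\<nu> + 1) k * pochhammer (\<nu> + 1 + real k) k)"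
      proof -
        have "pochhammer \<sigma> (2 * (n + k)) = pochhammer \<sigma> (2 * n) * pochhammer (\<sigma> + 2 * real n) (k + k)"
        proof -
          have eq: "2 * (n + k) = 2 * n + (k + k)" by simp
          show ?thesis unfolding eq pochhammer_product'[of \<sigma> "2 * n"] by simp
        qed
        also have "pochhammer (\<sigma> + 2 * real n) (k + k) = pochhammer (\<nu> + 1) k * pochhammer (\<nu> + 1 + real k) k"
          unfolding pochhammer_product'[of _ k k] by (simp add: \<nu>_def)
        finally show ?thesis .
      qed
      \<comment> \<open>The powers of 4 from the binomial expansion turn C into 2 C = 2 cosh (t/2),
        the base in the summation formula, and leave the factor 2^\<sigma>.\<close>
      have p2: "C powr (- \<sigma> - 2 * real (n + k)) = 2 powr \<sigma> * 4 ^ (n + k) * (2 * C) powr (- (\<nu> + 1 + 2 * real k))"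
      proof -
        have "(4::real) ^ (n + k) = 2 ^ (2 * (n + k))" unfolding power_mult by simp
        also have "\<dots> = 2 powr (2 * real (n + k))"
          using powr_realpow[of 2 "2 * (n + k)"] by simp
        finally have "(4::real) ^ (n + k) = 2 powr (2 * real (n + k))" .
        then have "2 powr \<sigma> * 4 ^ (n + k) = (2::real) powr (\<sigma> + 2 * real (n + k))"
          by (simp add: powr_add)
        moreover have "(2 * C) powr (- (\<nu> + 1 + 2 * real k)) = 2 powr (- (\<sigma> + 2 * real (n + k))) * C powr (- \<sigma> - 2 * real (n + k))"
          using C by (subst powr_mult) (auto simp: \<nu>_def algebra_simps)
        moreover have "(2::real) powr (\<sigma> + 2 * real (n + k)) * 2 powr (- (\<sigma> + 2 * real (n + k))) = 1"
          by (simp flip: powr_add)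
        ultimately show ?thesis by simp
      qed
      have l: "link_coeff n (n + k) = 1 / (appell_form n 1 1 * fact k * pochhammer (\<nu> + 1) k)"
        by (simp add: link_coeff_def \<nu>_def \<sigma>_def add_ac)
      have "pochhammer (\<nu> + 1) k > 0" using \<sigma> by (intro pochhammer_pos) (simp add: \<nu>_def)
      then show ?thesis unfolding f_def p1 p2 l D_def g_def by simp
    qed
    then have "(\<Sum>\<^sub>\<infinity>k. f \<theta> \<phi> n k) = D * (exp (- t * \<nu> / 2) / (2 * sinh (t / 2)))"
      by (simp add: infsum_cmult_right' g)
    moreover have "poisson_const \<alpha> \<beta> = 2 / (2 powr \<sigma> * B)"
    proof -
      have "- \<alpha> - \<beta> - 1 = 1 - \<sigma>" by (simp add: \<sigma>_def)
      then show ?thesis by (simp add: poisson_const_def measure_jacobi_measure B_def powr_diff)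
    qed
    moreover have "exp (- t * \<bar>real n + (\<alpha> + \<beta> + 1) / 2\<bar>) = exp (- t * \<nu> / 2)"
    proof -
      \<comment> \<open>Since \<alpha> + \<beta> \<ge> -1, the quantity is nonnegative also for n =
        0.\<close>
      have "\<bar>real n + (\<alpha> + \<beta> + 1) / 2\<bar> = \<nu> / 2" using assms by (simp add: \<nu>_def \<sigma>_def)
      then show ?thesis by simp
    qed
    moreover have "jacobi_trig n \<alpha> \<beta> \<theta> * jacobi_trig n \<alpha> \<beta> \<phi> = D / (2 powr \<sigma> * B)"
      using jacobi_trig_product[OF assms(4,5), of n] B by (simp add: D_def B_def X_def \<sigma>_def)
    ultimately show ?thesis using sinh_pos B by (simp add: mult.assoc)
  qed
  have "jacobi_poisson_kernel \<alpha> \<beta> t \<theta> \<phi> = poisson_const \<alpha> \<beta> * sinh (t / 2) * I \<theta> \<phi>"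
    unfolding jacobi_poisson_kernel_def 2 by (simp add: infsum_cmult_right' 1)
  also have "I \<theta> \<phi> = (\<integral>(u, v). 1 / (cosh (t / 2) - 1 + jacobi_q \<theta> \<phi> u v) powr (\<alpha> + \<beta> + 2)
       \<partial>(Pi_measure \<alpha> \<Otimes>\<^sub>M Pi_measure \<beta>))"
    by (simp add: I_def jacobi_q_def C_def \<sigma>_def algebra_simps)
  finally show ?thesis .
qed

end
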